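(* Let $0<p\le\infty$, $0<q<\infty$ and $0<\alpha<\infty$. (a) For every semigroup of analytic functions $(\varphi_t)_{t\ge0}$ in $\mathbb{D}$, the composition operators $C_tf=f\circ\varphi_t$ form a strongly continuous semigroup of operators on $H(p,q,\alpha)$, i.e. $\lim_{t\to0^+}\|f\circ\varphi_t-f\|_{p,q,\alpha}=0$ for every $f\in H(p,q,\alpha)$. (b) No non-trivial semigroup of analytic functions induces a uniformly continuous semigroup of composition operators on $H(p,q,\alpha)$; that is, if $\lim_{t\to0^+}\|C_t-I\|=0$ on $H(p,q,\alpha)$, then $\varphi_t$ is the identity for all $t\ge0$.
   Context: $\mathbb{D}$ is the unit disk. A semigroup of analytic functions is a family $\{\varphi_t:t\ge0\}$ of analytic self-maps of $\mathbb{D}$ with $\varphi_0=\mathrm{id}$, $\varphi_{t+s}=\varphi_t\circ\varphi_s$, and $\varphi_t\to\varphi_0$ uniformly on compact subsets as $t\to0^+$; it is trivial if every $\varphi_t$ is the identity. For $f$ analytic on $\mathbb{D}$, $M_p(r,f)=\left(\int_0^{2\pi}|f(re^{i\theta})|^p\frac{d\theta}{2\pi}\right)^{1/p}$ ($p<\infty$), $M_\infty(r,f)=\max_\theta|f(re^{i\theta})|$, and $H(p,q,\alpha)$ is the space of analytic $f$ on $\mathbb{D}$ with $\|f\|_{p,q,\alpha}^q=\alpha q\int_0^1(1-r)^{\alpha q-1}M_p^q(r,f)\,dr<\infty$. $I$ is the identity operator. *)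

theory Defs
  imports "HOL-Analysis.Analysis"
begin

abbreviation unit_disc :: "complex set" where
  "unit_disc \<equiv> ball 0 1"

definition analytic_semigroup :: "(real \<Rightarrow> complex \<Rightarrow> complex) \<Rightarrow> bool" where
  "analytic_semigroup \<phi> \<longleftrightarrow>
     (\<forall>t\<ge>0. \<phi> t holomorphic_on unit_disc \<and> \<phi> t ` unit_disc \<subseteq> unit_disc) \<and>
     (\<forall>z\<in>unit_disc. \<phi> 0 z = z) \<and>
     (\<forall>s\<ge>0. \<forall>t\<ge>0. \<forall>z\<in>unit_disc. \<phi> (t + s) z = \<phi> t (\<phi> s z)) \<and>
     (\<forall>K. compact K \<and> K \<subseteq> unit_disc \<longrightarrow> uniform_limit K \<phi> (\<phi> 0) (at_right 0))"

definition trivial_semigroup :: "(real \<Rightarrow> complex \<Rightarrow> complex) \<Rightarrow> bool" where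
  "trivial_semigroup \<phi> \<longleftrightarrow> (\<forall>t\<ge>0. \<forall>z\<in>unit_disc. \<phi> t z = z)"

definition Mp :: "ereal \<Rightarrow> real \<Rightarrow> (complex \<Rightarrow> complex) \<Rightarrow> real" where
  "Mp p r f =
     (if p = \<infinity> then (SUP \<theta>\<in>{0..2*pi}. norm (f (of_real r * cis \<theta>)))
      else (integral {0..2*pi} (\<lambda>\<theta>. norm (f (of_real r * cis \<theta>)) powr real_of_ereal p) / (2*pi))
             powr (1 / real_of_ereal p))"

definition Hnorm_pow :: "ereal \<Rightarrow> real \<Rightarrow> real \<Rightarrow> (complex \<Rightarrow> complex) \<Rightarrow> ennreal" where
  "Hnorm_pow p q \<alpha> f =
     (\<integral>\<^sup>+ r. indicator {0<..<1} r *
        ennreal (\<alpha> * q * (1 - r) powr (\<alpha> * q - 1) * Mp p r f powr q) \<partial>lborel)"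

definition Hspace :: "ereal \<Rightarrow> real \<Rightarrow> real \<Rightarrow> (complex \<Rightarrow> complex) set" where
  "Hspace p q \<alpha> = {f. f holomorphic_on unit_disc \<and> Hnorm_pow p q \<alpha> f < \<infinity>}"

definition Hnorm :: "ereal \<Rightarrow> real \<Rightarrow> real \<Rightarrow> (complex \<Rightarrow> complex) \<Rightarrow> real" where
  "Hnorm p q \<alpha> f = (enn2real (Hnorm_pow p q \<alpha> f)) powr (1 / q)"

definition comp_minus_id_opnorm ::
    "ereal \<Rightarrow> real \<Rightarrow> real \<Rightarrow> (complex \<Rightarrow> complex) \<Rightarrow> ereal" where
  "comp_minus_id_opnorm p q \<alpha> \<psi> =
     (SUP f\<in>{f\<in>Hspace p q \<alpha>. Hnorm p q \<alpha> f \<le> 1}.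
        (if (\<lambda>z. f (\<psi> z) - f z) \<in> Hspace p q \<alpha>
         then ereal (Hnorm p q \<alpha> (\<lambda>z. f (\<psi> z) - f z)) else \<infinity>))"

end

theory Submission
  imports Defs "HOL-Complex_Analysis.Complex_Analysis"
begin

text \<open>
  For every finite \<open>p > 0\<close> the function \<open>|f|\<^sup>p\<close> is dominated by the Poisson integral of its values on a
  circle; for \<open>p < 1\<close> this needs the zeros of \<open>f\<close> to be removed by Blaschke factors. Averaging that
  estimate along a self-map \<open>g\<close> of the disc gives \<open>M\<^sub>p(r, f \<circ> g) \<le> C M\<^sub>p(1 - c (1 - r), f)\<close> with constants
  depending only on a bound for \<open>|g(0)|\<close>. The weight \<open>(1 - r)\<close> scales well under \<open>r \<mapsto> 1 - c (1 - r)\<close>, so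
  composition operators are bounded, and along a semigroup the integrands of \<open>f \<circ> \<phi>\<^sub>t - f\<close> have a
  common integrable majorant for small \<open>t\<close>; dominated convergence then yields strong continuity.

  For the converse part, kernels \<open>1 / (1 - cnj a z)^N\<close> nearly attain the norm of the
  evaluation at \<open>a\<close>, uniformly in \<open>a\<close>. If the operator \<open>C\<^sub>g - I\<close> has small norm, testing it on these kernels gives
  \<open>|g(a) - a| = O(1 - |a|)\<close> for all \<open>a\<close>, so \<open>g(z) - z\<close> vanishes at the boundary and \<open>g\<close> is the
  identity by the maximum principle.
\<close>

subsection \<open>The Poisson kernel\<close>

text \<open>The Poisson kernel of the disc of radius \<open>R\<close> without the factor 1/(2 pi).
  Its integral over a period is therefore 2 pi, which explains the factors \<open>2 * pi\<close> in
  the estimates below.\<close>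

definition poisson_kernel :: "real \<Rightarrow> complex \<Rightarrow> real \<Rightarrow> real" where
  "poisson_kernel R w \<theta> = (R\<^sup>2 - (norm w)\<^sup>2) / (norm (of_real R * cis \<theta> - w))\<^sup>2"

lemma norm_circle: "0 \<le> R \<Longrightarrow> norm (complex_of_real R * cis \<theta>) = R"
  by (simp add: norm_mult)

lemma circle_neq:
  assumes "norm w < R" shows "complex_of_real R * cis \<theta> \<noteq> w"
proof -
  have "0 \<le> R" using assms norm_ge_zero[of w] by linarith
  then show ?thesis using assms norm_circle[of R \<theta>] by auto
qed

lemma poisson_kernel_nonneg: "norm w < R \<Longrightarrow> 0 \<le> poisson_kernel R w \<theta>"
  by (simp add: poisson_kernel_def abs_le_square_iff[symmetric])

text \<open>The numerator factors as (R + |w|)(R - |w|), and the distance from \<open>w\<close> to a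
  point of the circle lies between R - |w| and R + |w|. The lower bound serves Harnack's inequality,
  the upper one the constants in the mean and growth estimates.\<close>

lemma poisson_kernel_bounds:
  assumes "norm w < R"
  shows "(R - norm w) / (R + norm w) \<le> poisson_kernel R w \<theta>"
    and "poisson_kernel R w \<theta> \<le> (R + norm w) / (R - norm w)"
proof -
  define d where "d = norm (of_real R * cis \<theta> - w)"
  have R: "0 < R" using assms norm_ge_zero[of w] by linarith
  have d1: "d \<le> R + norm w"
    unfolding d_def using norm_triangle_ineq4[of "of_real R * cis \<theta>" w] norm_circle[of R \<theta>] R by auto
  have d2: "R - norm w \<le> d"
    unfolding d_def using norm_triangle_ineq2[of "of_real R * cis \<theta>" w] norm_circle[of R \<theta>] R by auto
  have eq: "R\<^sup>2 - (norm w)\<^sup>2 = (R + norm w) * (R - norm w)"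
    by (simp add: power2_eq_square algebra_simps)
  have pos: "0 < R - norm w" "0 < R + norm w" "0 < d" using assms R d2 norm_ge_zero[of w] by linarith+
  have "(R - norm w) / (R + norm w) = (R + norm w) * (R - norm w) / (R + norm w)\<^sup>2"
    using pos by (simp add: power2_eq_square)
  also have "\<dots> \<le> (R + norm w) * (R - norm w) / d\<^sup>2"
    using pos d1 by (intro divide_left_mono) auto
  finally show "(R - norm w) / (R + norm w) \<le> poisson_kernel R w \<theta>"
    by (simp add: poisson_kernel_def eq d_def)
  have "(R + norm w) * (R - norm w) / d\<^sup>2 \<le> (R + norm w) * (R - norm w) / (R - norm w)\<^sup>2"
    using pos d2 by (intro divide_left_mono) auto
  also have "\<dots> = (R + norm w) / (R - norm w)"
    using pos by (simp add: power2_eq_square)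
  finally show "poisson_kernel R w \<theta> \<le> (R + norm w) / (R - norm w)"
    by (simp add: poisson_kernel_def eq d_def)
qed

text \<open>Exhibits the kernel as the real part of a function holomorphic in \<open>w\<close>,
  hence as a harmonic function that stays harmonic after a holomorphic substitution for
  \<open>w\<close>.\<close>

lemma poisson_kernel_eq_Re:
  assumes "norm w < R"
  shows "poisson_kernel R w \<theta> = Re ((of_real R * cis \<theta> + w) / (of_real R * cis \<theta> - w))"
proof -
  define u where "u = complex_of_real R * cis \<theta>"
  have ne: "u - w \<noteq> 0" using circle_neq[OF assms, of \<theta>] by (simp add: u_def)
  have "0 \<le> R" using assms norm_ge_zero[of w] by linarith
  then have nu: "norm u = R" by (simp add: u_def norm_circle)
  have "(u + w) / (u - w) = (u + w) * cnj (u - w) / of_real ((norm (u - w))\<^sup>2)"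
    using complex_div_cnj[of "u + w" "u - w"] by simp
  then have "Re ((u + w) / (u - w)) = Re ((u + w) * cnj (u - w)) / (norm (u - w))\<^sup>2"
    by (simp add: Re_divide_of_real del: of_real_power)
  also have "Re ((u + w) * cnj (u - w)) = (norm u)\<^sup>2 - (norm w)\<^sup>2"
    unfolding cmod_power2 by (simp add: algebra_simps power2_eq_square)
  finally show ?thesis unfolding poisson_kernel_def u_def[symmetric] by (simp add: nu)
qed

lemma continuous_on_poisson_kernel:
  assumes "continuous_on A R" "continuous_on A w" "continuous_on A \<theta>"
    and "\<And>x. x \<in> A \<Longrightarrow> norm (w x) < R x"
  shows "continuous_on A (\<lambda>x. poisson_kernel (R x) (w x) (\<theta> x))"
  unfolding poisson_kernel_def
  using circle_neq[OF assms(4)] by (intro continuous_intros assms(1-3)) auto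

text \<open>Cauchy's formula for \<open>K(u) (R\<^sup>2 - |w|\<^sup>2) / (R\<^sup>2 - cnj w u)\<close>, a function that agrees with \<open>K\<close>
  at \<open>w\<close>.\<close>

lemma poisson_formula:
  fixes K :: "complex \<Rightarrow> complex"
  assumes K: "continuous_on (cball 0 R) K" "K holomorphic_on ball 0 R" and w: "norm w < R"
  shows "((\<lambda>\<theta>. of_real (poisson_kernel R w \<theta>) * K (of_real R * cis \<theta>)) has_integral 2 * pi * K w) {0..2*pi}"
proof -
  define F where "F u = K u * (of_real (R\<^sup>2 - (norm w)\<^sup>2) / (of_real (R\<^sup>2) - cnj w * u))" for u
  have R: "0 < R" using w norm_ge_zero[of w] by linarith
  have ne: "of_real (R\<^sup>2) - cnj w * u \<noteq> 0" if "norm u \<le> R" for u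
  proof
    assume "of_real (R\<^sup>2) - cnj w * u = 0"
    then have "norm (complex_of_real (R\<^sup>2)) = norm (cnj w * u)" by simp
    then have "R * R = norm w * norm u" using R by (simp add: norm_mult power2_eq_square)
    also have "\<dots> < R * R" using that w R
      by (intro le_less_trans[OF mult_left_mono[OF that]] mult_strict_right_mono) auto
    finally show False by simp
  qed
  have "continuous_on (cball 0 R) F"
    unfolding F_def using ne by (intro continuous_intros K) auto
  moreover have "F holomorphic_on ball 0 R"
    unfolding F_def using ne by (intro holomorphic_intros K) auto
  ultimately have "((\<lambda>u. F u / (u - w)) has_contour_integral 2 * of_real pi * \<i> * F w) (circlepath 0 R)"
    using w by (intro Cauchy_integral_circlepath) auto
  then have "((\<lambda>t. F (R * cis t) / (R * cis t - w) * R * \<i> * cis t) has_integral 2 * of_real pi * \<i> * F w) {0..2*pi}"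
    unfolding circlepath_def by (subst (asm) has_contour_integral_part_circlepath_iff) auto
  then have "((\<lambda>t. (F (R * cis t) / (R * cis t - w) * R * \<i> * cis t) * (- \<i>)) has_integral 2 * of_real pi * \<i> * F w * (-\<i>)) {0..2*pi}"
    by (rule has_integral_mult_left)
  moreover have "F w = K w"
  proof -
    have "cnj w * w = of_real ((norm w)\<^sup>2)" by (metis complex_norm_square mult.commute of_real_power)
    then show ?thesis using ne[of w] w by (simp add: F_def)
  qed
  \<comment> \<open>On the circle R^2 = u cnj u, so the denominator of \<open>F\<close> splits off a
    factor \<open>u\<close>, which cancels the one coming from du = i u dt.\<close>
  moreover have "(F (R * cis t) / (R * cis t - w) * R * \<i> * cis t) * (- \<i>) = of_real (poisson_kernel R w t) * K (R * cis t)" for t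
  proof -
    define u where "u = complex_of_real R * cis t"
    have nu: "norm u = R" using R by (simp add: u_def norm_circle)
    have uw: "u \<noteq> w" using nu w by auto
    have u0: "u \<noteq> 0" using nu R by auto
    have e1: "complex_of_real (R\<^sup>2) = u * cnj u" unfolding nu[symmetric]
      by (metis complex_norm_square of_real_power)
    have e2: "complex_of_real ((norm (u - w))\<^sup>2) = (u - w) * (cnj u - cnj w)"
      by (metis complex_cnj_diff complex_norm_square of_real_power)
    have d: "cnj u - cnj w \<noteq> 0" using uw by (metis complex_cnj_cancel_iff right_minus_eq)
    have P: "of_real (poisson_kernel R w t) = of_real (R\<^sup>2 - (norm w)\<^sup>2) / ((u - w) * (cnj u - cnj w))"
      unfolding poisson_kernel_def u_def[symmetric] of_real_divide e2 ..
    have "(F u / (u - w) * R * \<i> * cis t) * (- \<i>) = F u * u / (u - w)"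
      by (simp add: u_def mult_ac)
    also have "\<dots> = K u * (of_real (R\<^sup>2 - (norm w)\<^sup>2) / (u * (cnj u - cnj w))) * u / (u - w)"
      unfolding F_def e1 by (simp add: algebra_simps)
    also have "\<dots> = of_real (poisson_kernel R w t) * K u"
      unfolding P using u0 by (simp add: mult_ac)
    finally show ?thesis unfolding u_def .
  qed
  ultimately show ?thesis by (simp add: mult_ac)
qed

lemma circle_mean_value:
  fixes K :: "complex \<Rightarrow> complex"
  assumes "continuous_on (cball 0 R) K" "K holomorphic_on ball 0 R" "0 < R"
  shows "((\<lambda>\<theta>. K (of_real R * cis \<theta>)) has_integral 2 * pi * K 0) {0..2*pi}"
  using poisson_formula[of R K 0] assms by (simp add: poisson_kernel_def norm_mult)

text \<open>The bound on \<open>g\<close> keeps the pole of \<open>H\<close> away from the values of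
  \<open>g\<close>, so \<open>H\<close> is holomorphic on the closed disc of radius
  \<open>r\<close>; the claim is the real part of its mean value property.\<close>

lemma poisson_kernel_comp_integral:
  assumes g: "g holomorphic_on ball 0 1" and r: "0 < r" "r < 1"
    and b: "\<And>z. norm z \<le> r \<Longrightarrow> norm (g z) < R"
  shows "integral {0..2*pi} (\<lambda>\<tau>. poisson_kernel R (g (of_real r * cis \<tau>)) \<theta>) = 2 * pi * poisson_kernel R (g 0) \<theta>"
proof -
  define H where "H z = (of_real R * cis \<theta> + g z) / (of_real R * cis \<theta> - g z)" for z
  have holg: "g holomorphic_on cball 0 r" by (rule holomorphic_on_subset[OF g]) (use r in auto)
  have "H holomorphic_on cball 0 r"
    unfolding H_def using circle_neq[OF b] by (intro holomorphic_intros holg) auto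
  then have "((\<lambda>\<tau>. H (of_real r * cis \<tau>)) has_integral 2 * pi * H 0) {0..2*pi}"
    by (intro circle_mean_value r holomorphic_on_imp_continuous_on)
      (auto elim: holomorphic_on_subset)
  then have "((\<lambda>\<tau>. Re (H (of_real r * cis \<tau>))) has_integral Re (2 * pi * H 0)) {0..2*pi}"
    by (rule has_integral_Re)
  moreover have "Re (H z) = poisson_kernel R (g z) \<theta>" if "norm z \<le> r" for z
    unfolding H_def using poisson_kernel_eq_Re[OF b[OF that]] by simp
  ultimately show ?thesis
    using r by (simp add: integral_unique norm_circle)
qed

subsection \<open>Subharmonicity of powers of the modulus\<close>

text \<open>Globalises the local factorisation at a zero: the local factor near \<open>a\<close> and
  the quotient by (z - a)^n elsewhere agree on the overlap of two open sets covering
  \<open>S\<close>.\<close>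

lemma holomorphic_divide_out_zero:
  assumes f: "f holomorphic_on S" and S: "open S" "connected S" and a: "a \<in> S" "f a = 0"
    and nc: "\<not> f constant_on S"
  obtains n G where "G holomorphic_on S" "G a \<noteq> 0" "0 < n" "\<And>z. z \<in> S \<Longrightarrow> f z = (z - a) ^ n * G z"
proof -
  obtain g r n where g: "0 < n" "0 < r" "ball a r \<subseteq> S" "g holomorphic_on ball a r"
    "\<And>w. w \<in> ball a r \<Longrightarrow> f w = (w - a) ^ n * g w" "\<And>w. w \<in> ball a r \<Longrightarrow> g w \<noteq> 0"
    using holomorphic_factor_zero_nonconstant[OF f S a nc] by metis
  define G where "G z = (if z = a then g a else f z / (z - a) ^ n)" for z
  have "G holomorphic_on ball a r"
    by (rule holomorphic_transform[OF g(4)]) (auto simp: G_def g(5))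
  moreover have "G holomorphic_on S - {a}"
  proof -
    have "(\<lambda>z. f z / (z - a) ^ n) holomorphic_on S - {a}"
      by (intro holomorphic_intros holomorphic_on_subset[OF f]) auto
    then show ?thesis by (rule holomorphic_transform) (auto simp: G_def)
  qed
  ultimately have "G holomorphic_on (ball a r \<union> (S - {a}))"
    using S by (intro holomorphic_on_Un) (auto simp: open_Diff)
  moreover have "ball a r \<union> (S - {a}) = S" using g(2,3) a by auto
  ultimately show thesis using that[of G n] g a by (auto simp: G_def)
qed

text \<open>The first two claims come from |R^2 - cnj a z|^2 - R^2 |z - a|^2 = (R^2 - |a|^2)(R^2 -
  |z|^2), whose right side is nonnegative on the closed disc and zero on the circle.\<close>

lemma blaschke_numerator_bound:
  fixes a z :: complex
  assumes R: "0 < R" and a: "norm a < R"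
  shows "norm z \<le> R \<Longrightarrow> norm (z - a) \<le> norm ((of_real (R\<^sup>2) - cnj a * z) / of_real R)"
    and "norm z = R \<Longrightarrow> norm ((of_real (R\<^sup>2) - cnj a * z) / of_real R) = norm (z - a)"
    and "norm z \<le> R \<Longrightarrow> (of_real (R\<^sup>2) - cnj a * z) / of_real R \<noteq> 0"
proof -
  have id: "(norm (of_real (R\<^sup>2) - cnj a * z))\<^sup>2 - (R * norm (z - a))\<^sup>2 = (R\<^sup>2 - (norm a)\<^sup>2) * (R\<^sup>2 - (norm z)\<^sup>2)"
    unfolding power_mult_distrib cmod_power2 by (simp add: algebra_simps power2_eq_square)
  have a2: "0 < R\<^sup>2 - (norm a)\<^sup>2" using a R by (simp add: power_strict_mono)
  show "norm (z - a) \<le> norm ((of_real (R\<^sup>2) - cnj a * z) / of_real R)" if "norm z \<le> R"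
  proof -
    have "0 \<le> R\<^sup>2 - (norm z)\<^sup>2" using that R by (simp add: power_mono)
    then have "(R * norm (z - a))\<^sup>2 \<le> (norm (of_real (R\<^sup>2) - cnj a * z))\<^sup>2"
      using id a2 by (metis diff_ge_0_iff_ge less_imp_le mult_nonneg_nonneg)
    then have "R * norm (z - a) \<le> norm (of_real (R\<^sup>2) - cnj a * z)"
      by (rule power2_le_imp_le) simp
    then show ?thesis using R by (simp add: norm_divide field_simps)
  qed
  show "norm ((of_real (R\<^sup>2) - cnj a * z) / of_real R) = norm (z - a)" if "norm z = R"
  proof -
    have "(R * norm (z - a))\<^sup>2 = (norm (of_real (R\<^sup>2) - cnj a * z))\<^sup>2"
      using id that by simp
    then have "R * norm (z - a) = norm (of_real (R\<^sup>2) - cnj a * z)"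
      using R by (simp add: power2_eq_iff_nonneg)
    then show ?thesis using R by (simp add: norm_divide field_simps)
  qed
  show "(of_real (R\<^sup>2) - cnj a * z) / of_real R \<noteq> 0" if "norm z \<le> R"
  proof
    assume "(of_real (R\<^sup>2) - cnj a * z) / of_real R = 0"
    then have "of_real (R\<^sup>2) = cnj a * z" using R by simp
    then have "norm (complex_of_real (R\<^sup>2)) = norm (cnj a * z)" by simp
    then have "R * R = norm a * norm z" using R by (simp add: norm_mult power2_eq_square)
    also have "\<dots> < R * R" using that a R
      by (intro le_less_trans[OF mult_left_mono[OF that]] mult_strict_right_mono) auto
    finally show False by simp
  qed
qed

text \<open>Each factor \<open>z - a\<close> is traded for the Blaschke numerator \<open>(R\<^sup>2 - cnj a z) / R\<close>, which has the same
  modulus on the circle, a larger one inside, and no zero there.\<close>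

lemma zero_free_majorant:
  assumes R: "0 < R" "R < 1"
  assumes "f holomorphic_on ball 0 1" "\<exists>z\<in>ball 0 1. f z \<noteq> 0"
  shows "\<exists>h. h holomorphic_on ball 0 1 \<and> (\<forall>z\<in>ball 0 R. h z \<noteq> 0) \<and>
     (\<forall>z. norm z \<le> R \<longrightarrow> norm (f z) \<le> norm (h z)) \<and> (\<forall>z. norm z = R \<longrightarrow> norm (h z) = norm (f z))"
  using assms(3,4)
\<comment> \<open>Induction on the number of distinct zeros in the open disc: each step removes one
  zero together with its full multiplicity \<open>n\<close>.\<close>
proof (induction "card {z\<in>ball 0 R. f z = 0}" arbitrary: f rule: less_induct)
  case less
  show ?case
  proof (cases "\<exists>a\<in>ball 0 R. f a = 0")
    case False
    then show ?thesis using less.prems by (intro exI[of _ f]) auto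
  next
    case True
    then obtain a where a: "norm a < R" "f a = 0" by auto
    have a1: "a \<in> ball 0 1" using a R by auto
    have nc: "\<not> f constant_on ball 0 1"
      using less.prems(2) a a1 by (metis constant_on_def)
    obtain n G where G: "G holomorphic_on ball 0 1" "G a \<noteq> 0" "0 < n"
      and fG: "\<And>z. z \<in> ball 0 1 \<Longrightarrow> f z = (z - a) ^ n * G z"
      using holomorphic_divide_out_zero[OF less.prems(1) open_ball connected_ball a1 a(2) nc] by metis
    \<comment> \<open>Finiteness makes \<open>card\<close> a genuine count, so that a proper subset
      of the zero set has smaller cardinality; it holds because the closed disc is compact in the
      unit disc.\<close>
    have "finite {z\<in>cball 0 R. f z = 0}"
      by (rule holomorphic_compact_finite_zeros[OF less.prems(1)]) (use R nc in auto)
    then have fin: "finite {z\<in>ball 0 R. f z = 0}"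
      by (rule rev_finite_subset) auto
    define B where "B z = (of_real (R\<^sup>2) - cnj a * z) / of_real R" for z
    define f1 where "f1 z = B z ^ n * G z" for z
    have B: "norm z \<le> R \<Longrightarrow> norm (z - a) \<le> norm (B z)" "norm z = R \<Longrightarrow> norm (B z) = norm (z - a)"
      "norm z \<le> R \<Longrightarrow> B z \<noteq> 0" for z
      unfolding B_def by (intro blaschke_numerator_bound R a; assumption)+
    have ff1: "norm (f z) \<le> norm (f1 z)" if "norm z \<le> R" for z
      using fG[of z] that R B(1)[OF that]
      by (auto simp: f1_def norm_mult norm_power intro!: mult_right_mono power_mono)
    have ff1': "norm (f1 z) = norm (f z)" if "norm z = R" for z
      using fG[of z] that R B(2)[OF that] by (auto simp: f1_def norm_mult norm_power)
    \<comment> \<open>As |f| <= |f1| on the disc, no new zeros appear; \<open>a\<close> is lost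
      because \<open>B a\<close> and \<open>G a\<close> are nonzero.\<close>
    have "{z\<in>ball 0 R. f1 z = 0} \<subset> {z\<in>ball 0 R. f z = 0}"
    proof (rule psubsetI)
      show "{z\<in>ball 0 R. f1 z = 0} \<subseteq> {z\<in>ball 0 R. f z = 0}"
      proof safe
        fix z assume "z \<in> ball 0 R" "f1 z = 0"
        then show "f z = 0" using ff1[of z] by simp
      qed
      have "f1 a \<noteq> 0" using B(3)[of a] a G by (auto simp: f1_def)
      then show "{z\<in>ball 0 R. f1 z = 0} \<noteq> {z\<in>ball 0 R. f z = 0}" using a by auto
    qed
    then have card: "card {z\<in>ball 0 R. f1 z = 0} < card {z\<in>ball 0 R. f z = 0}"
      using fin by (rule psubset_card_mono[rotated])
    have holf1: "f1 holomorphic_on ball 0 1"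
      unfolding f1_def B_def using R by (intro holomorphic_intros G) auto
    have nz1: "\<exists>z\<in>ball 0 1. f1 z \<noteq> 0"
      using B(3)[of a] a a1 G by (auto simp: f1_def intro!: bexI[of _ a])
    obtain h where h: "h holomorphic_on ball 0 1" "\<forall>z\<in>ball 0 R. h z \<noteq> 0"
      "\<forall>z. norm z \<le> R \<longrightarrow> norm (f1 z) \<le> norm (h z)" "\<forall>z. norm z = R \<longrightarrow> norm (h z) = norm (f1 z)"
      using less.hyps[OF card holf1 nz1] by blast
    have "norm (f z) \<le> norm (h z)" if "norm z \<le> R" for z
      using order_trans[OF ff1[OF that]] h(3) that by blast
    moreover have "norm (h z) = norm (f z)" if "norm z = R" for z
      using ff1'[OF that] h(4) that by simp
    ultimately show ?thesis using h(1,2) by blast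
  qed
qed

section \<open>Poisson majorants for powers of the modulus\<close>

lemma continuous_on_norm_powr_circle:
  fixes f :: "complex \<Rightarrow> complex"
  assumes f: "continuous_on (ball 0 1) f" and p: "0 < p"
    and c: "continuous_on A s" "continuous_on A \<theta>" and s: "\<And>x. x \<in> A \<Longrightarrow> 0 \<le> s x \<and> s x < 1"
  shows "continuous_on A (\<lambda>x. norm (f (of_real (s x) * cis (\<theta> x))) powr p)"
proof -
  have "continuous_on A (\<lambda>x. f (of_real (s x) * cis (\<theta> x)))"
    by (rule continuous_on_compose2[OF f]) (use s in \<open>auto simp: norm_mult intro!: continuous_intros c\<close>)
  then show ?thesis using p by (intro continuous_on_powr' continuous_intros) auto
qed

text \<open>A zero-free \<open>h\<close> has a holomorphic logarithm \<open>g\<close>, so |h|^p is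
  the modulus of the holomorphic exp(p g), to which the Poisson formula and the triangle inequality
  apply. The logarithm exists only on the open disc, since \<open>h\<close> may vanish on its
  boundary, so the inequality is proved for radii \<open>s\<close> below \<open>R\<close> and passed
  to the limit.\<close>

lemma norm_powr_le_poisson_zero_free:
  assumes R: "0 < R" "R < 1" and h: "h holomorphic_on ball 0 1" and nz: "\<And>z. z \<in> ball 0 R \<Longrightarrow> h z \<noteq> 0"
    and p: "0 < p" and w: "norm w < R"
  shows "2 * pi * norm (h w) powr p \<le>
    integral {0..2*pi} (\<lambda>\<theta>. poisson_kernel R w \<theta> * norm (h (of_real R * cis \<theta>)) powr p)"
proof -
  define I where "I s = integral {0..2*pi} (\<lambda>\<theta>. poisson_kernel s w \<theta> * norm (h (of_real s * cis \<theta>)) powr p)" for s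
  have hc: "continuous_on (ball 0 1) h" using h by (rule holomorphic_on_imp_continuous_on)
  obtain g where g: "g holomorphic_on ball 0 R" "\<And>z. z \<in> ball 0 R \<Longrightarrow> exp (g z) = h z"
    using holomorphic_logarithm_exists[of "ball 0 R" h 0] holomorphic_on_subset[OF h, of "ball 0 R"] nz R
    by (metis centre_in_ball convex_ball open_ball order_less_imp_le subset_ball)
  define K where "K z = exp (of_real p * g z)" for z
  have hK: "K holomorphic_on ball 0 R" unfolding K_def by (intro holomorphic_intros g)
  have nK: "norm (K z) = norm (h z) powr p" if "z \<in> ball 0 R" for z
    using g(2)[OF that] unfolding K_def by (simp add: norm_exp_eq_Re powr_def flip: g(2)[OF that])
  have ineq: "2 * pi * norm (h w) powr p \<le> I s" if s: "norm w < s" "s < R" for s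
  proof -
    have s0: "0 < s" using s norm_ge_zero[of w] by linarith
    have "((\<lambda>\<theta>. of_real (poisson_kernel s w \<theta>) * K (of_real s * cis \<theta>)) has_integral 2 * pi * K w) {0..2*pi}"
      using s by (intro poisson_formula holomorphic_on_imp_continuous_on holomorphic_on_subset[OF hK]) auto
    moreover have "norm (integral {0..2*pi} (\<lambda>\<theta>. of_real (poisson_kernel s w \<theta>) * K (of_real s * cis \<theta>))) \<le> I s"
      unfolding I_def
    proof (rule integral_norm_bound_integral)
      show "(\<lambda>\<theta>. of_real (poisson_kernel s w \<theta>) * K (of_real s * cis \<theta>)) integrable_on {0..2*pi}"
        using calculation by blast
      show "(\<lambda>\<theta>. poisson_kernel s w \<theta> * norm (h (of_real s * cis \<theta>)) powr p) integrable_on {0..2*pi}"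
        by (intro integrable_continuous_real continuous_intros continuous_on_poisson_kernel
            continuous_on_norm_powr_circle hc p) (use s s0 R in auto)
    next
      fix \<theta> show "norm (of_real (poisson_kernel s w \<theta>) * K (of_real s * cis \<theta>))
         \<le> poisson_kernel s w \<theta> * norm (h (of_real s * cis \<theta>)) powr p"
        using nK[of "of_real s * cis \<theta>"] poisson_kernel_nonneg[OF s(1), of \<theta>] s s0
        by (simp add: norm_mult)
    qed
    ultimately show ?thesis using nK[of w] w by (simp add: integral_unique norm_mult)
  qed
  define s0 where "s0 = (norm w + R) / 2"
  have s0: "norm w < s0" "s0 < R" using w by (auto simp: s0_def)
  \<comment> \<open>The integrand involves \<open>h\<close> and not the logarithm, so it is jointly
    continuous up to and including the radius \<open>R\<close>.\<close>
  have "continuous_on {s0..R} (\<lambda>s. integral (cbox 0 (2*pi)) (\<lambda>\<theta>. poisson_kernel s w \<theta> * norm (h (of_real s * cis \<theta>)) powr p))"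
  proof (rule integral_continuous_on_param)
    show "continuous_on ({s0..R} \<times> cbox 0 (2*pi)) (\<lambda>(s, \<theta>). poisson_kernel s w \<theta> * norm (h (of_real s * cis \<theta>)) powr p)"
      unfolding split_beta
      by (intro continuous_intros continuous_on_poisson_kernel continuous_on_norm_powr_circle hc p)
        (use s0 R norm_ge_zero[of w] in \<open>auto simp del: norm_ge_zero\<close>)
  qed
  then have "continuous_on {s0..R} I" by (simp add: I_def[abs_def])
  then have "(I \<longlongrightarrow> I R) (at R within {s0..R})"
    using s0 by (auto simp: continuous_on_def)
  then have "(I \<longlongrightarrow> I R) (at_left R)"
    using s0 by (simp add: at_within_Icc_at_left)
  moreover have "eventually (\<lambda>s. 2 * pi * norm (h w) powr p \<le> I s) (at_left R)"
    using eventually_at_left_real[OF s0(2)] by eventually_elim (use ineq s0 in auto)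
  ultimately show ?thesis unfolding I_def[symmetric]
    by (intro tendsto_lowerbound) auto
qed

text \<open>Replacing \<open>f\<close> by its zero-free majorant can only increase the left side and
  leaves the moduli on the circle unchanged. The zero function has no place in the majorant lemma
  and is treated apart.\<close>

lemma norm_powr_le_poisson:
  assumes R: "R < 1" and f: "f holomorphic_on ball 0 1" and p: "0 < p" and w: "norm w < R"
  shows "2 * pi * norm (f w) powr p \<le>
    integral {0..2*pi} (\<lambda>\<theta>. poisson_kernel R w \<theta> * norm (f (of_real R * cis \<theta>)) powr p)"
proof (cases "\<exists>z\<in>ball 0 1. f z \<noteq> 0")
  case False
  moreover have "0 < R" using w norm_ge_zero[of w] by linarith
  ultimately have "f w = 0" "f (of_real R * cis \<theta>) = 0" for \<theta>
    using w R by (auto simp: norm_mult)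
  then show ?thesis by simp
next
  case True
  have R0: "0 < R" using w norm_ge_zero[of w] by linarith
  obtain h where h: "h holomorphic_on ball 0 1" "\<And>z. z\<in>ball 0 R \<Longrightarrow> h z \<noteq> 0"
     "\<And>z. norm z \<le> R \<Longrightarrow> norm (f z) \<le> norm (h z)" "\<And>z. norm z = R \<Longrightarrow> norm (h z) = norm (f z)"
    using zero_free_majorant[OF R0 R f True] by blast
  have "2 * pi * norm (f w) powr p \<le> 2 * pi * norm (h w) powr p"
    using h(3)[of w] w p by (intro mult_left_mono powr_mono2) auto
  also have "\<dots> \<le> integral {0..2*pi} (\<lambda>\<theta>. poisson_kernel R w \<theta> * norm (h (of_real R * cis \<theta>)) powr p)"
    by (rule norm_powr_le_poisson_zero_free) (use R0 R h p w in auto)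
  finally show ?thesis using h(4) R0 by (simp add: norm_circle)
qed

text \<open>Harnack's inequality for the positive harmonic function \<open>1 - Re (u g)\<close>, with the unimodular \<open>u\<close>
  chosen so that \<open>u g(z) = |g(z)|\<close>.\<close>

lemma self_map_boundary_distance:
  assumes g: "g holomorphic_on ball 0 1" "g ` ball 0 1 \<subseteq> ball 0 1" and b: "norm (g 0) \<le> b" "b < 1"
    and z: "norm z < 1"
  shows "(1 - b) / 2 * (1 - norm z) \<le> 1 - norm (g z)"
proof -
  \<comment> \<open>If \<open>g z = 0\<close>, the convention \<open>sgn 0 = 0\<close> gives
    \<open>u = 0\<close>; what the argument uses is |u| <= 1 and u g(z) = |g(z)|, true in both
    cases.\<close>
  define u where "u = cnj (sgn (g z))"
  define K where "K x = 1 - u * g x" for x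
  have nu: "norm u \<le> 1" by (simp add: u_def norm_sgn)
  have "u * g z = norm (g z)"
  proof (cases "g z = 0")
    case False
    have "g z * cnj (g z) = of_real (norm (g z)) * of_real (norm (g z))"
      by (simp add: complex_norm_square[symmetric] power2_eq_square)
    then show ?thesis using False by (simp add: u_def sgn_eq field_simps)
  qed simp
  then have Kz: "Re (K z) = 1 - norm (g z)" by (simp add: K_def)
  have Re_ug: "Re (u * g x) \<le> norm (g x)" for x
  proof -
    have "Re (u * g x) \<le> norm u * norm (g x)" using complex_Re_le_cmod[of "u * g x"] by (simp add: norm_mult)
    also have "\<dots> \<le> 1 * norm (g x)" using nu by (intro mult_right_mono) auto
    finally show ?thesis by simp
  qed
  have K0: "1 - b \<le> Re (K 0)" using Re_ug[of 0] b by (simp add: K_def)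
  have Kpos: "0 \<le> Re (K x)" if "norm x < 1" for x
  proof -
    have "norm (g x) < 1" using g(2) that by (auto simp: image_subset_iff)
    then show ?thesis using Re_ug[of x] by (simp add: K_def)
  qed
  have hK: "K holomorphic_on ball 0 1" unfolding K_def by (intro holomorphic_intros g)
  have main: "(s - norm z) / 2 * (1 - b) \<le> 1 - norm (g z)" if s: "norm z < s" "s < 1" for s
  proof -
    have s0: "0 < s" using s norm_ge_zero[of z] by linarith
    have hKs: "K holomorphic_on cball 0 s" by (rule holomorphic_on_subset[OF hK]) (use s in auto)
    have "((\<lambda>\<theta>. of_real (poisson_kernel s z \<theta>) * K (of_real s * cis \<theta>)) has_integral 2 * pi * K z) {0..2*pi}"
      by (intro poisson_formula holomorphic_on_imp_continuous_on[OF hKs] holomorphic_on_subset[OF hKs] s) auto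
    from has_integral_Re[OF this]
    have 1: "((\<lambda>\<theta>. poisson_kernel s z \<theta> * Re (K (of_real s * cis \<theta>))) has_integral 2 * pi * Re (K z)) {0..2*pi}"
      by simp
    have "((\<lambda>\<theta>. K (of_real s * cis \<theta>)) has_integral 2 * pi * K 0) {0..2*pi}"
      by (intro circle_mean_value holomorphic_on_imp_continuous_on[OF hKs] holomorphic_on_subset[OF hKs] s0) auto
    from has_integral_mult_right[OF has_integral_Re[OF this], of "(s - norm z) / 2"]
    have 2: "((\<lambda>\<theta>. (s - norm z) / 2 * Re (K (of_real s * cis \<theta>))) has_integral (s - norm z) / 2 * (2 * pi * Re (K 0))) {0..2*pi}"
      by simp
    have "(s - norm z) / 2 * (2 * pi * Re (K 0)) \<le> 2 * pi * Re (K z)"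
    proof (rule has_integral_le[OF 2 1])
      fix \<theta>
      \<comment> \<open>Here s + |z| is below 2; this is the source of the factor 1/2 in the
        conclusion.\<close>
      have "(s - norm z) / 2 \<le> (s - norm z) / (s + norm z)"
        using s z s0 by (intro divide_left_mono) (auto intro: add_pos_nonneg)
      also have "\<dots> \<le> poisson_kernel s z \<theta>" by (rule poisson_kernel_bounds[OF s(1)])
      finally show "(s - norm z) / 2 * Re (K (of_real s * cis \<theta>)) \<le> poisson_kernel s z \<theta> * Re (K (of_real s * cis \<theta>))"
        using Kpos[of "of_real s * cis \<theta>"] s s0 by (intro mult_right_mono) (auto simp: norm_mult)
    qed
    then have "(2 * pi) * ((s - norm z) / 2 * Re (K 0)) \<le> (2 * pi) * Re (K z)" by (simp add: mult_ac)
    then have "(s - norm z) / 2 * Re (K 0) \<le> Re (K z)"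
      by (rule mult_left_le_imp_le) simp
    moreover have "(s - norm z) / 2 * (1 - b) \<le> (s - norm z) / 2 * Re (K 0)"
      using K0 s by (intro mult_left_mono) auto
    ultimately show ?thesis using Kz by linarith
  qed
  have "((\<lambda>s. (s - norm z) / 2 * (1 - b)) \<longlongrightarrow> (1 - norm z) / 2 * (1 - b)) (at_left 1)"
    by (intro tendsto_intros) auto
  moreover have "eventually (\<lambda>s. (s - norm z) / 2 * (1 - b) \<le> 1 - norm (g z)) (at_left 1)"
    using eventually_at_left_real[OF z] by eventually_elim (use main in auto)
  ultimately have "(1 - norm z) / 2 * (1 - b) \<le> 1 - norm (g z)"
    by (intro tendsto_upperbound) auto
  then show ?thesis by (simp add: mult_ac)
qed

subsection \<open>Integral means\<close>

lemma ereal_pos_cases: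
  assumes "0 < (p::ereal)"
  obtains "p = \<infinity>" | P where "p = ereal P" "0 < P"
  using assms by (cases p) auto

text \<open>The sum is at most twice the maximum. This crude form covers every positive exponent,
  convex or concave.\<close>

lemma powr_add_le:
  fixes x y s :: real
  assumes "0 \<le> x" "0 \<le> y" "0 < s"
  shows "(x + y) powr s \<le> 2 powr s * (x powr s + y powr s)"
proof -
  have "(x + y) powr s \<le> (2 * max x y) powr s" using assms by (intro powr_mono2) auto
  also have "\<dots> = 2 powr s * max x y powr s" using assms by (simp add: powr_mult)
  also have "\<dots> \<le> 2 powr s * (x powr s + y powr s)" by (intro mult_left_mono) (auto simp: max_def)
  finally show ?thesis .
qed

text \<open>The \<open>P\<close>-th power of the integral mean: before the root is taken it is
  linear in |f|^P, so integral estimates are carried out on it.\<close>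

definition circle_mean :: "real \<Rightarrow> real \<Rightarrow> (complex \<Rightarrow> complex) \<Rightarrow> real" where
  "circle_mean P r f = integral {0..2*pi} (\<lambda>\<theta>. norm (f (of_real r * cis \<theta>)) powr P) / (2*pi)"

lemma Mp_ereal: "Mp (ereal P) r f = circle_mean P r f powr (1 / P)"
  by (simp add: Mp_def circle_mean_def)

lemma Mp_PInf: "Mp \<infinity> r f = (SUP \<theta>\<in>{0..2*pi}. norm (f (of_real r * cis \<theta>)))"
  by (simp add: Mp_def)

lemma norm_powr_circle_integrable:
  fixes f :: "complex \<Rightarrow> complex"
  assumes "continuous_on (ball 0 1) f" "0 < P" "0 \<le> r" "r < 1"
  shows "(\<lambda>\<theta>. norm (f (of_real r * cis \<theta>)) powr P) integrable_on {0..2*pi}"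
  using assms by (intro integrable_continuous_real continuous_on_norm_powr_circle continuous_intros) auto

lemma circle_mean_nonneg:
  assumes "continuous_on (ball 0 1) f" "0 < P" "0 \<le> r" "r < 1"
  shows "0 \<le> circle_mean P r f"
  using norm_powr_circle_integrable[OF assms] by (simp add: circle_mean_def integral_nonneg)

lemma circle_mean_mono:
  assumes "continuous_on (ball 0 1) f" "0 < P" "0 \<le> r" "r < 1"
    and "g integrable_on {0..2*pi}"
    and "\<And>\<theta>. norm (f (of_real r * cis \<theta>)) powr P \<le> g \<theta>"
  shows "circle_mean P r f \<le> integral {0..2*pi} g / (2*pi)"
  unfolding circle_mean_def
  using norm_powr_circle_integrable[OF assms(1-4)] assms(5,6)
  by (intro divide_right_mono integral_le) auto

text \<open>A real-valued \<open>SUP\<close> is an upper bound only for sets bounded above, so every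
  use of the mean for \<open>p = \<infinity>\<close> rests on this.\<close>

lemma norm_circle_bdd_above:
  fixes f :: "complex \<Rightarrow> complex"
  assumes "continuous_on (ball 0 1) f" "0 \<le> r" "r < 1"
  shows "bdd_above ((\<lambda>\<theta>. norm (f (of_real r * cis \<theta>))) ` {0..2*pi})"
proof -
  have "continuous_on {0..2*pi} (\<lambda>\<theta>. norm (f (of_real r * cis \<theta>)) powr 1)"
    using assms by (intro continuous_on_norm_powr_circle continuous_intros) auto
  then have "continuous_on {0..2*pi} (\<lambda>\<theta>. norm (f (of_real r * cis \<theta>)))" by simp
  then show ?thesis
    by (intro bounded_imp_bdd_above compact_imp_bounded compact_continuous_image) auto
qed

lemma Mp_nonneg:
  assumes "0 < p" "continuous_on (ball 0 1) f" "0 \<le> r" "r < 1"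
  shows "0 \<le> Mp p r f"
  using assms(1)
proof (cases rule: ereal_pos_cases)
  case 1
  have "0 \<le> norm (f (of_real r * cis 0))" by simp
  also have "\<dots> \<le> Mp \<infinity> r f" unfolding Mp_PInf
    using norm_circle_bdd_above[OF assms(2-4)] by (intro cSUP_upper) auto
  finally show ?thesis using 1 by simp
qed (simp add: Mp_ereal)

lemma Mp_le_bound:
  assumes "0 < p" "continuous_on (ball 0 1) f" "0 \<le> r" "r < 1" "0 \<le> B"
    and B: "\<And>z. norm z = r \<Longrightarrow> norm (f z) \<le> B"
  shows "Mp p r f \<le> B"
  using assms(1)
proof (cases rule: ereal_pos_cases)
  case 1
  then show ?thesis using B assms by (auto simp: Mp_PInf norm_mult intro!: cSUP_least)
next
  case (2 P)
  have "circle_mean P r f \<le> integral {0..2*pi} (\<lambda>\<theta>. B powr P) / (2*pi)"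
    using assms 2 by (intro circle_mean_mono powr_mono2 B) (auto simp: norm_mult)
  then have "circle_mean P r f powr (1/P) \<le> (B powr P) powr (1/P)"
    using circle_mean_nonneg[OF assms(2) 2(2) assms(3,4)] 2 by (intro powr_mono2) auto
  then show ?thesis using 2 assms(5) by (simp add: Mp_ereal powr_powr)
qed

text \<open>A quasi-triangle inequality with a constant depending on \<open>p\<close> alone, since
  Minkowski's inequality fails for p < 1. The inequality for powers of sums is applied under the
  integral with exponent \<open>P\<close> and again to the root with exponent
  \<open>1/P\<close>.\<close>

lemma Mp_diff_le:
  assumes "0 < p"
  obtains K where "0 \<le> K" "\<And>f g r. continuous_on (ball 0 1) f \<Longrightarrow> continuous_on (ball 0 1) g \<Longrightarrow> 0 \<le> r \<Longrightarrow> r < 1 \<Longrightarrow>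
    Mp p r (\<lambda>z. f z - g z) \<le> K * (Mp p r f + Mp p r g)"
  using assms
proof (cases rule: ereal_pos_cases)
  case 1
  have "Mp p r (\<lambda>z. f z - g z) \<le> 1 * (Mp p r f + Mp p r g)"
    if "continuous_on (ball 0 1) f" "continuous_on (ball 0 1) g" "0 \<le> r" "r < 1" for f g r
    unfolding 1 Mp_PInf
  proof (rule cSUP_least)
    fix \<theta> :: real assume "\<theta> \<in> {0..2*pi}"
    then have "norm (f (of_real r * cis \<theta>)) \<le> (SUP \<theta>\<in>{0..2*pi}. norm (f (of_real r * cis \<theta>)))"
       "norm (g (of_real r * cis \<theta>)) \<le> (SUP \<theta>\<in>{0..2*pi}. norm (g (of_real r * cis \<theta>)))"
      using norm_circle_bdd_above that by (auto intro!: cSUP_upper)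
    then show "norm (f (of_real r * cis \<theta>) - g (of_real r * cis \<theta>)) \<le> 1 * ((SUP \<theta>\<in>{0..2*pi}. norm (f (of_real r * cis \<theta>))) +
       (SUP \<theta>\<in>{0..2*pi}. norm (g (of_real r * cis \<theta>))))"
      unfolding mult_1_left by (rule order_trans[OF norm_triangle_ineq4 add_mono])
  qed auto
  then show ?thesis using that[of 1] by auto
next
  case (2 P)
  have "Mp p r (\<lambda>z. f z - g z) \<le> (2 * 2 powr (1/P)) * (Mp p r f + Mp p r g)"
    if fg: "continuous_on (ball 0 1) f" "continuous_on (ball 0 1) g" and r: "0 \<le> r" "r < 1" for f g r
  proof -
    let ?f = "\<lambda>\<theta>. norm (f (of_real r * cis \<theta>)) powr P" and ?g = "\<lambda>\<theta>. norm (g (of_real r * cis \<theta>)) powr P"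
    have int: "?f integrable_on {0..2*pi}" "?g integrable_on {0..2*pi}"
      using norm_powr_circle_integrable fg r 2 by auto
    have "circle_mean P r (\<lambda>z. f z - g z) \<le> integral {0..2*pi} (\<lambda>\<theta>. 2 powr P * (?f \<theta> + ?g \<theta>)) / (2*pi)"
    proof (rule circle_mean_mono)
      fix \<theta>
      have "norm (f (of_real r * cis \<theta>) - g (of_real r * cis \<theta>)) powr P \<le> (norm (f (of_real r * cis \<theta>)) + norm (g (of_real r * cis \<theta>))) powr P"
        using 2 by (intro powr_mono2 norm_triangle_ineq4) auto
      also have "\<dots> \<le> 2 powr P * (?f \<theta> + ?g \<theta>)" using 2 by (intro powr_add_le) auto
      finally show "norm (f (of_real r * cis \<theta>) - g (of_real r * cis \<theta>)) powr P \<le> 2 powr P * (?f \<theta> + ?g \<theta>)" .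
    qed (use fg r 2 int in \<open>auto intro!: continuous_intros integrable_add\<close>)
    also have "\<dots> = 2 powr P * (circle_mean P r f + circle_mean P r g)"
      using int by (simp add: circle_mean_def Henstock_Kurzweil_Integration.integral_add add_divide_distrib distrib_left)
    finally have "circle_mean P r (\<lambda>z. f z - g z) powr (1/P) \<le> (2 powr P * (circle_mean P r f + circle_mean P r g)) powr (1/P)"
      using 2 fg r by (intro powr_mono2 circle_mean_nonneg continuous_intros) auto
    also have "\<dots> = 2 * (circle_mean P r f + circle_mean P r g) powr (1/P)"
      using 2 circle_mean_nonneg[OF fg(1) 2(2) r] circle_mean_nonneg[OF fg(2) 2(2) r]
      by (simp add: powr_mult powr_powr)
    also have "\<dots> \<le> 2 * (2 powr (1/P) * (circle_mean P r f powr (1/P) + circle_mean P r g powr (1/P)))"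
      using 2 circle_mean_nonneg[OF fg(1) 2(2) r] circle_mean_nonneg[OF fg(2) 2(2) r]
      by (intro mult_left_mono powr_add_le) auto
    finally show ?thesis by (simp add: 2 Mp_ereal mult.assoc)
  qed
  then show ?thesis using that[of "2 * 2 powr (1/P)"] by auto
qed

text \<open>Maximum modulus principle; for \<open>p = \<infinity>\<close> it takes the place of the
  Poisson majorant.\<close>

lemma norm_le_Mp_PInf:
  assumes f: "f holomorphic_on ball 0 1" and R: "0 < R" "R < 1" and w: "norm w \<le> R"
  shows "norm (f w) \<le> Mp \<infinity> R f"
proof (rule maximum_modulus_frontier[of f "cball 0 R"])
  show "f holomorphic_on interior (cball 0 R)"
    by (rule holomorphic_on_subset[OF f]) (use R in auto)
  show "continuous_on (closure (cball 0 R)) f"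
    by (rule continuous_on_subset[OF holomorphic_on_imp_continuous_on[OF f]]) (use R in auto)
  show "norm (f z) \<le> Mp \<infinity> R f" if "z \<in> frontier (cball 0 R)" for z
  proof -
    have z: "norm z = R" using that R by auto
    have "z = of_real R * cis (Arg2pi z)"
      using Arg2pi_eq[of z] z by (simp add: cis_conv_exp mult.commute)
    moreover have "Arg2pi z \<in> {0..2*pi}" using Arg2pi_ge_0[of z] Arg2pi_lt_2pi[of z] by auto
    ultimately show ?thesis unfolding Mp_PInf
      using norm_circle_bdd_above[OF holomorphic_on_imp_continuous_on[OF f], of R] R
      by (metis (mono_tags, lifting) cSUP_upper less_imp_le)
  qed
qed (use w in auto)

text \<open>For \<open>p = \<infinity>\<close> the mean increases with the radius by the maximum
  principle; for finite \<open>p\<close> it is continuous in the radius.\<close>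

lemma Mp_measurable:
  assumes p: "0 < p" and f: "f holomorphic_on ball 0 1"
  shows "(\<lambda>r. Mp p r f) \<in> borel_measurable (restrict_space borel {0<..<1})"
  using p
proof (cases rule: ereal_pos_cases)
  case 1
  have "mono_on {0<..<1} (\<lambda>r. Mp \<infinity> r f)"
  proof (rule mono_onI)
    fix r s :: real assume rs: "r \<in> {0<..<1}" "s \<in> {0<..<1}" "r \<le> s"
    show "Mp \<infinity> r f \<le> Mp \<infinity> s f"
      unfolding Mp_PInf[of r] by (rule cSUP_least) (use rs in \<open>auto simp: norm_mult intro!: norm_le_Mp_PInf[OF f]\<close>)
  qed
  then show ?thesis unfolding 1 by (rule borel_measurable_mono_on_fnc)
next
  case (2 P)
  have fc: "continuous_on (ball 0 1) f" by (rule holomorphic_on_imp_continuous_on[OF f])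
  have "continuous_on {0<..<1} (\<lambda>r. integral (cbox 0 (2*pi)) (\<lambda>\<theta>. norm (f (of_real r * cis \<theta>)) powr P))"
    unfolding split_beta
    by (intro integral_continuous_on_param[unfolded split_beta] continuous_on_norm_powr_circle fc 2 continuous_intros) auto
  then have "continuous_on {0<..<1} (\<lambda>r. circle_mean P r f)"
    unfolding circle_mean_def by (intro continuous_intros) auto
  then have "continuous_on {0<..<1} (\<lambda>r. Mp p r f)"
    unfolding 2 Mp_ereal using 2 circle_mean_nonneg[OF fc 2(2)]
    by (intro continuous_on_powr' continuous_intros) auto
  then show ?thesis by (rule borel_measurable_continuous_on_restrict)
qed

text \<open>Littlewood subordination: \<open>|f|\<^sup>P\<close> is dominated by its Poisson integral over the circle of radius
  \<open>R\<close>, and \<open>poisson_kernel R (g z) \<theta>\<close> is harmonic in \<open>z\<close>, so its mean over the circle of radius \<open>r\<close> is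
  its value at \<open>0\<close>.\<close>

lemma Mp_comp_le:
  assumes p: "0 < p" and b: "0 \<le> b" "b < 1"
  obtains C where "0 \<le> C" "\<And>f g r. \<lbrakk>f holomorphic_on ball 0 1; g holomorphic_on ball 0 1; g ` ball 0 1 \<subseteq> ball 0 1;
     norm (g 0) \<le> b; 0 < r; r < 1\<rbrakk> \<Longrightarrow> Mp p r (f \<circ> g) \<le> C * Mp p (1 - (1 - b) / 4 * (1 - r)) f"
proof -
  \<comment> \<open>\<open>real_of_ereal (inverse p)\<close> is \<open>1 / P\<close> for finite
    \<open>p\<close> and 0 for \<open>p = \<infinity>\<close>, so one formula serves both cases,
    with constant 1 in the latter.\<close>
  have main: "Mp p r (f \<circ> g) \<le> (4 / (1 - b)) powr real_of_ereal (inverse p) * Mp p (1 - (1 - b) / 4 * (1 - r)) f"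
    if f: "f holomorphic_on ball 0 1" and g: "g holomorphic_on ball 0 1" "g ` ball 0 1 \<subseteq> ball 0 1" "norm (g 0) \<le> b"
      and r: "0 < r" "r < 1" for f g r
  proof -
    \<comment> \<open>Half of the gap guaranteed by \<open>self_map_boundary_distance\<close>: the
      values of \<open>g\<close> on the closed disc of radius \<open>r\<close> stay strictly inside
      radius \<open>R\<close>, while \<open>R\<close> keeps a distance of at least (1 - b)/2 from
      |g(0)|.\<close>
    define R where "R = 1 - (1 - b) / 4 * (1 - r)"
    have "(1 - b) / 4 * (1 - r) \<le> (1 - b) / 4 * 1" using b r by (intro mult_left_mono) auto
    moreover have "0 < (1 - b) / 4 * (1 - r)" using b r by simp
    ultimately have R: "0 < R" "R < 1" and Rb: "(1 - b) / 2 \<le> R - norm (g 0)"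
      unfolding R_def using b g(3) by (auto simp: field_simps)
    have gR: "norm (g z) < R" if "norm z \<le> r" for z
    proof -
      have "(1 - b) / 4 * (1 - r) < (1 - b) / 2 * (1 - r)" using b r by (intro mult_strict_right_mono) auto
      also have "\<dots> \<le> (1 - b) / 2 * (1 - norm z)" using that b by (intro mult_left_mono) auto
      also have "\<dots> \<le> 1 - norm (g z)" using self_map_boundary_distance[OF g b(2)] that r by auto
      finally show ?thesis by (simp add: R_def)
    qed
    have fc: "continuous_on (ball 0 1) f" by (rule holomorphic_on_imp_continuous_on[OF f])
    have gc: "continuous_on (ball 0 1) g" by (rule holomorphic_on_imp_continuous_on[OF g(1)])
    have fgc: "continuous_on (ball 0 1) (f \<circ> g)"
      by (rule continuous_on_compose[OF gc continuous_on_subset[OF fc g(2)]])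
    show ?thesis unfolding R_def[symmetric] using p
    proof (cases rule: ereal_pos_cases)
      case 1
      have "Mp \<infinity> r (f \<circ> g) \<le> Mp \<infinity> R f"
        unfolding Mp_PInf[of r]
      proof (rule cSUP_least)
        fix \<theta> :: real
        have "norm (g (of_real r * cis \<theta>)) \<le> R" using gR r by (simp add: norm_mult less_imp_le)
        then show "norm ((f \<circ> g) (of_real r * cis \<theta>)) \<le> Mp \<infinity> R f"
          using norm_le_Mp_PInf[OF f R] by simp
      qed auto
      then show "Mp p r (f \<circ> g) \<le> (4 / (1 - b)) powr real_of_ereal (inverse p) * Mp p R f" using 1 b by simp
    next
      case (2 P)
      let ?F = "\<lambda>\<theta>. norm (f (of_real R * cis \<theta>)) powr P"
      let ?k = "\<lambda>\<tau> \<theta>. poisson_kernel R (g (of_real r * cis \<tau>)) \<theta>"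
      have grc: "continuous_on A (\<lambda>x. g (of_real r * cis (\<tau> x)))" if "continuous_on A \<tau>" for A and \<tau> :: "'a::topological_space \<Rightarrow> real"
        by (rule continuous_on_compose2[OF gc]) (use that r in \<open>auto simp: norm_mult intro!: continuous_intros\<close>)
      have cont: "continuous_on (cbox (0,0) (2*pi,2*pi)) (\<lambda>(\<tau>,\<theta>). ?k \<tau> \<theta> * ?F \<theta>)"
        unfolding split_beta
        by (intro continuous_intros continuous_on_poisson_kernel continuous_on_norm_powr_circle fc grc 2 gR)
          (use R r in \<open>auto simp: norm_mult\<close>)
      have cont1: "continuous_on (cbox 0 (2*pi)) (\<lambda>\<tau>. integral (cbox 0 (2*pi)) (\<lambda>\<theta>. ?k \<tau> \<theta> * ?F \<theta>))"
        by (rule integral_continuous_on_param) (use cont in \<open>simp add: cbox_Pair_eq\<close>)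
      have F: "?F integrable_on {0..2*pi}" using norm_powr_circle_integrable[OF fc 2(2)] R by simp
      have "circle_mean P r (f \<circ> g) \<le> integral {0..2*pi} (\<lambda>\<tau>. integral {0..2*pi} (\<lambda>\<theta>. ?k \<tau> \<theta> * ?F \<theta>) / (2*pi)) / (2*pi)"
      proof (rule circle_mean_mono[OF fgc 2(2)])
        show "(\<lambda>\<tau>. integral {0..2*pi} (\<lambda>\<theta>. ?k \<tau> \<theta> * ?F \<theta>) / (2*pi)) integrable_on {0..2*pi}"
          using cont1 by (intro integrable_continuous_real continuous_intros) auto
        fix \<tau>
        have "norm (g (of_real r * cis \<tau>)) < R" using gR r by (simp add: norm_mult)
        from norm_powr_le_poisson[OF R(2) f 2(2) this]
        show "norm ((f \<circ> g) (of_real r * cis \<tau>)) powr P \<le> integral {0..2*pi} (\<lambda>\<theta>. ?k \<tau> \<theta> * ?F \<theta>) / (2*pi)"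
          by (simp add: field_simps)
      qed (use r in auto)
      \<comment> \<open>After the exchange the inner integral averages the kernel along
        \<open>g\<close>, and harmonicity evaluates it at \<open>g 0\<close>.\<close>
      also have "\<dots> = integral {0..2*pi} (\<lambda>\<theta>. integral {0..2*pi} (\<lambda>\<tau>. ?k \<tau> \<theta> * ?F \<theta>)) / (2*pi) / (2*pi)"
        using integral_swap_continuous[OF cont] by simp
      also have "\<dots> = integral {0..2*pi} (\<lambda>\<theta>. poisson_kernel R (g 0) \<theta> * ?F \<theta>) / (2*pi)"
        using poisson_kernel_comp_integral[OF g(1) r gR] by (simp add: mult.assoc)
      also have "\<dots> \<le> integral {0..2*pi} (\<lambda>\<theta>. 4 / (1 - b) * ?F \<theta>) / (2*pi)"
      proof (intro divide_right_mono integral_le mult_right_mono)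
        fix \<theta>
        have "(R + norm (g 0)) / (R - norm (g 0)) \<le> 2 / ((1 - b) / 2)"
          using Rb R g(3) b by (intro frac_le) auto
        then show "poisson_kernel R (g 0) \<theta> \<le> 4 / (1 - b)"
          using poisson_kernel_bounds(2)[OF gR[of 0], of \<theta>] r by simp
      next
        show "(\<lambda>\<theta>. poisson_kernel R (g 0) \<theta> * ?F \<theta>) integrable_on {0..2*pi}"
          using gR[of 0] r R by (intro integrable_continuous_real continuous_intros continuous_on_poisson_kernel continuous_on_norm_powr_circle fc 2) auto
      qed (use integrable_on_mult_right[OF F, of "4 / (1 - b)"] in auto)
      also have "\<dots> = 4 / (1 - b) * circle_mean P R f" by (simp add: circle_mean_def)
      finally have "circle_mean P r (f \<circ> g) powr (1/P) \<le> (4 / (1 - b) * circle_mean P R f) powr (1/P)"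
        using 2 circle_mean_nonneg[OF fgc 2(2)] r by (intro powr_mono2) auto
      also have "\<dots> = (4 / (1 - b)) powr (1/P) * circle_mean P R f powr (1/P)"
        by (rule powr_mult)
      finally show "Mp p r (f \<circ> g) \<le> (4 / (1 - b)) powr real_of_ereal (inverse p) * Mp p R f"
        using 2 by (simp add: Mp_ereal inverse_eq_divide)
    qed
  qed
  show thesis by (rule that[of "(4 / (1 - b)) powr real_of_ereal (inverse p)", OF _ main]) auto
qed

text \<open>For finite \<open>p\<close> the kernel in the Poisson majorant is replaced by its upper
  bound; for \<open>p = \<infinity>\<close> the exponent is 0 and the maximum principle
  applies.\<close>

lemma norm_le_Mp:
  assumes p: "0 < p" and f: "f holomorphic_on ball 0 1" and w: "norm w < R" and R: "R < 1"
  shows "norm (f w) \<le> ((R + norm w) / (R - norm w)) powr real_of_ereal (inverse p) * Mp p R f"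
  using p
proof (cases rule: ereal_pos_cases)
  case 1
  have "0 < R" using w norm_ge_zero[of w] by linarith
  \<comment> \<open>Since \<open>0 powr 0 = 0\<close>, the base has to be nonzero for the factor to
    become 1.\<close>
  then show ?thesis using 1 w R norm_le_Mp_PInf[OF f, of R w] by (auto simp: add_nonneg_eq_0_iff)
next
  case (2 P)
  let ?F = "\<lambda>\<theta>. norm (f (of_real R * cis \<theta>)) powr P"
  let ?c = "(R + norm w) / (R - norm w)"
  have fc: "continuous_on (ball 0 1) f" by (rule holomorphic_on_imp_continuous_on[OF f])
  have R0: "0 < R" using w norm_ge_zero[of w] by linarith
  have F: "?F integrable_on {0..2*pi}" using norm_powr_circle_integrable[OF fc 2(2)] R R0 by simp
  have "2 * pi * norm (f w) powr P \<le> integral {0..2*pi} (\<lambda>\<theta>. poisson_kernel R w \<theta> * ?F \<theta>)"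
    by (rule norm_powr_le_poisson[OF R f 2(2) w])
  also have "\<dots> \<le> integral {0..2*pi} (\<lambda>\<theta>. ?c * ?F \<theta>)"
  proof (intro integral_le mult_right_mono poisson_kernel_bounds w)
    show "(\<lambda>\<theta>. poisson_kernel R w \<theta> * ?F \<theta>) integrable_on {0..2*pi}"
      using w R R0 by (intro integrable_continuous_real continuous_intros continuous_on_poisson_kernel continuous_on_norm_powr_circle fc 2) auto
    show "(\<lambda>\<theta>. ?c * ?F \<theta>) integrable_on {0..2*pi}" using integrable_on_mult_right[OF F] .
  qed auto
  also have "\<dots> = 2 * pi * (?c * circle_mean P R f)" by (simp add: circle_mean_def)
  finally have "norm (f w) powr P \<le> ?c * circle_mean P R f"
    by (rule mult_left_le_imp_le) simp
  then have "(norm (f w) powr P) powr (1/P) \<le> (?c * circle_mean P R f) powr (1/P)"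
    using 2 by (intro powr_mono2) auto
  also have "\<dots> = ?c powr (1/P) * circle_mean P R f powr (1/P)"
    by (rule powr_mult)
  finally show ?thesis using 2 by (simp add: Mp_ereal powr_powr inverse_eq_divide)
qed

section \<open>Integral means of the test kernels\<close>

lemma one_minus_cnj_mult_ge:
  assumes "norm a < 1" "norm z = r" "r < 1"
  shows "1 - norm a * r \<le> norm (1 - cnj a * z)" "0 < 1 - norm a * r"
proof -
  have "norm (1::complex) - norm (cnj a * z) \<le> norm (1 - cnj a * z)" by (rule norm_triangle_ineq2)
  then show "1 - norm a * r \<le> norm (1 - cnj a * z)" using assms by (simp add: norm_mult)
  have "norm a * r \<le> norm a * 1" using assms by (intro mult_left_mono) auto
  then show "0 < 1 - norm a * r" using assms(1) by linarith
qed

text \<open>Put x = |a| r. For finite \<open>P\<close>, |1 - cnj a z|^(-2) is a Poisson kernel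
  divided by 1 - x^2, with known integral. The condition on \<open>N\<close> means N P >= 2, so the
  remaining power of the distance has exponent at most 0 and is largest at the least distance 1 -
  x.\<close>

lemma Mp_kernel_le:
  assumes p: "0 < p" and a: "norm a < 1" and A: "0 \<le> A" and r: "0 < r" "r < 1"
    and N: "2 * real_of_ereal (inverse p) \<le> real N"
  shows "Mp p r (\<lambda>z. of_real A / (1 - cnj a * z) ^ N) \<le> A * (1 - norm a * r) powr (real_of_ereal (inverse p) - N)"
proof -
  define x where "x = norm a * r"
  have x0: "0 \<le> x" using r by (simp add: x_def)
  have x: "1 - x \<le> norm (1 - cnj a * z)" "0 < 1 - x" if "norm z = r" for z
    using one_minus_cnj_mult_ge[OF a that r(2)] by (auto simp: x_def)
  have x1: "0 < 1 - x" using x(2)[of "of_real r"] r by simp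
  have ne: "1 - cnj a * z \<noteq> 0" if "norm z < 1" for z
    using one_minus_cnj_mult_ge[OF a refl that] by auto
  have fc: "continuous_on (ball 0 1) (\<lambda>z. of_real A / (1 - cnj a * z) ^ N)"
    by (intro continuous_intros) (use ne in auto)
  show ?thesis unfolding x_def[symmetric] using p
  proof (cases rule: ereal_pos_cases)
    case 1
    have "Mp p r (\<lambda>z. of_real A / (1 - cnj a * z) ^ N) \<le> A / (1 - x) ^ N"
    proof (rule Mp_le_bound[OF p fc])
      fix z :: complex assume z: "norm z = r"
      show "norm (of_real A / (1 - cnj a * z) ^ N) \<le> A / (1 - x) ^ N"
        using x[OF z] A ne[of z] z r by (auto simp: norm_divide norm_power intro!: divide_left_mono power_mono mult_pos_pos)
    qed (use r A x1 in auto)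
    also have "\<dots> = A * (1 - x) powr (real_of_ereal (inverse p) - N)"
      using x1 1 by (simp add: powr_minus powr_realpow divide_inverse)
    finally show "Mp p r (\<lambda>z. of_real A / (1 - cnj a * z) ^ N) \<le> A * (1 - x) powr (real_of_ereal (inverse p) - N)" .
  next
    case (2 P)
    have NP: "2 \<le> N * P" using N 2 by (simp add: field_simps)
    define w where "w = a * of_real r"
    have nw: "norm w = x" using r by (simp add: w_def x_def norm_mult)
    have eq: "norm (1 - cnj a * (of_real r * cis \<theta>)) = norm (cis \<theta> - w)" for \<theta>
    proof -
      have "norm (cis \<theta> - w) = norm (cnj (cis \<theta> - w))" by (rule complex_mod_cnj[symmetric])
      also have "\<dots> = norm (cis \<theta> * cnj (cis \<theta> - w))" by (simp add: norm_mult)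
      also have "cis \<theta> * cnj (cis \<theta> - w) = 1 - cnj a * (of_real r * cis \<theta>)"
        by (simp add: w_def algebra_simps cis_cnj cis_mult)
      finally show ?thesis by simp
    qed
    let ?c = "A powr P * (1 - x) powr (2 - N * P) / (1 - x\<^sup>2)"
    have x2: "0 < 1 - x\<^sup>2" using x1 x0 by (simp add: power_less_one_iff abs_square_less_1)
    have "((\<lambda>\<theta>. complex_of_real (poisson_kernel 1 w \<theta>) * 1) has_integral of_real (2 * pi) * 1) {0..2*pi}"
      using poisson_formula[of 1 "\<lambda>_. 1" w] x1 nw by simp
    from has_integral_Re[OF this]
    have pk: "(poisson_kernel 1 w has_integral 2 * pi) {0..2*pi}" by simp
    have "circle_mean P r (\<lambda>z. of_real A / (1 - cnj a * z) ^ N) \<le> integral {0..2*pi} (\<lambda>\<theta>. ?c * poisson_kernel 1 w \<theta>) / (2*pi)"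
    proof (rule circle_mean_mono[OF fc 2(2)])
      show "(\<lambda>\<theta>. ?c * poisson_kernel 1 w \<theta>) integrable_on {0..2*pi}"
        by (rule integrable_on_mult_right) (use pk in blast)
      fix \<theta>
      define d where "d = norm (1 - cnj a * (of_real r * cis \<theta>))"
      have d: "1 - x \<le> d" using x(1)[of "of_real r * cis \<theta>"] r by (simp add: d_def norm_mult)
      have "norm (of_real A / (1 - cnj a * (of_real r * cis \<theta>)) ^ N) powr P = (A / d ^ N) powr P"
        using A by (simp add: norm_divide norm_power d_def)
      also have "\<dots> = A powr P * d powr (- (N * P))"
      proof -
        have "(A / d ^ N) powr P = A powr P / d powr (N * P)"
          using A d x1 by (simp add: powr_divide powr_realpow[symmetric] powr_powr)
        then show ?thesis by (simp add: powr_minus divide_inverse)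
      qed
      also have "d powr (- (N * P)) = d powr (2 - N * P) * d powr (-2)"
        by (simp add: powr_add[symmetric])
      also have "d powr (2 - N * P) * d powr (-2) \<le> (1 - x) powr (2 - N * P) * d powr (-2)"
        using d x1 NP by (intro mult_right_mono powr_mono2') auto
      also have "d powr (-2) = 1 / (1 - x\<^sup>2) * poisson_kernel 1 w \<theta>"
        using x2 d x1 by (simp add: poisson_kernel_def nw eq[symmetric] d_def powr_minus divide_inverse)
      finally show "norm (of_real A / (1 - cnj a * (of_real r * cis \<theta>)) ^ N) powr P \<le> ?c * poisson_kernel 1 w \<theta>"
        using A by (simp add: mult_left_mono mult.assoc)
    qed (use r in auto)
    also have "\<dots> = ?c" using pk by (simp add: integral_unique)
    also have "\<dots> \<le> A powr P * (1 - x) powr (2 - N * P) / (1 - x)"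
    proof (rule divide_left_mono)
      have "x\<^sup>2 \<le> x * 1" unfolding power2_eq_square using x0 x1 by (intro mult_left_mono) auto
      then show "1 - x \<le> 1 - x\<^sup>2" by simp
    qed (use x1 x2 in auto)
    also have "\<dots> = A powr P * (1 - x) powr (1 - N * P)"
    proof -
      have "(1 - x) powr (2 - N * P) = (1 - x) powr (1 - N * P) * (1 - x) powr 1"
        unfolding powr_add[symmetric] by simp
      then show ?thesis using x1 by simp
    qed
    finally have "circle_mean P r (\<lambda>z. of_real A / (1 - cnj a * z) ^ N) powr (1/P) \<le> (A powr P * (1 - x) powr (1 - N * P)) powr (1/P)"
      using circle_mean_nonneg[OF fc 2(2)] r 2 by (intro powr_mono2) auto
    also have "\<dots> = A * (1 - x) powr (1/P - N)"
      using 2 A by (simp add: powr_mult powr_powr diff_divide_distrib)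
    finally show "Mp p r (\<lambda>z. of_real A / (1 - cnj a * z) ^ N) \<le> A * (1 - x) powr (real_of_ereal (inverse p) - N)"
      using 2 by (simp add: Mp_ereal inverse_eq_divide)
  qed
qed

subsection \<open>Composition operators and strong continuity\<close>

text \<open>Measurability of \<open>Mp\<close> is known on the open interval; multiplying
  \<open>Mp\<close> by the indicator carries it to the line without changing the integrand.\<close>

lemma Hnorm_pow_integrand_measurable:
  assumes "0 < p" "f holomorphic_on ball 0 1"
  shows "(\<lambda>r. indicator {0<..<1} r * ennreal (\<alpha> * q * (1 - r) powr (\<alpha> * q - 1) * Mp p r f powr q)) \<in> borel_measurable borel"
proof -
  have [measurable]: "(\<lambda>r. indicator {0<..<1} r *\<^sub>R Mp p r f) \<in> borel_measurable borel"
    using Mp_measurable[OF assms] by (subst (asm) borel_measurable_restrict_space_iff) auto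
  have "(\<lambda>r. indicator {0<..<1} r * ennreal (\<alpha> * q * (1 - r) powr (\<alpha> * q - 1) * (indicator {0<..<1} r *\<^sub>R Mp p r f) powr q)) \<in> borel_measurable borel"
    by measurable
  also have "(\<lambda>r. indicator {0<..<1} r * ennreal (\<alpha> * q * (1 - r) powr (\<alpha> * q - 1) * (indicator {0<..<1} r *\<^sub>R Mp p r f) powr q)) =
    (\<lambda>r. indicator {0<..<1} r * ennreal (\<alpha> * q * (1 - r) powr (\<alpha> * q - 1) * Mp p r f powr q))"
    by (auto simp: fun_eq_iff indicator_def)
  finally show ?thesis .
qed

text \<open>The substitution R = 1 - c (1 - r) multiplies 1 - r by \<open>c\<close>, so the weight
  changes by a constant power of \<open>c\<close>. \<open>D\<close> lives on the whole line, so its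
  integral is a constant times the full norm integral of \<open>f\<close>.\<close>

lemma Hnorm_pow_dilation:
  assumes p: "0 < p" and f: "f \<in> Hspace p q \<alpha>" and c: "0 < c" "c < 1" and aq: "0 < \<alpha>" "0 < q"
  obtains D where "D \<in> borel_measurable borel" "(\<integral>\<^sup>+ r. D r \<partial>lborel) < \<infinity>"
    "\<And>r. 0 < r \<Longrightarrow> r < 1 \<Longrightarrow> ennreal (\<alpha> * q * (1 - r) powr (\<alpha> * q - 1) * Mp p (1 - c * (1 - r)) f powr q) = D r"
proof -
  define g where "g r = indicator {0<..<1} r * ennreal (\<alpha> * q * (1 - r) powr (\<alpha> * q - 1) * Mp p r f powr q)" for r
  define D where "D r = ennreal (c powr (1 - \<alpha> * q)) * g ((1 - c) + c * r)" for r
  have [measurable]: "g \<in> borel_measurable borel"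
    unfolding g_def using f by (intro Hnorm_pow_integrand_measurable p) (auto simp: Hspace_def)
  have "(\<integral>\<^sup>+ r. g r \<partial>lborel) = Hnorm_pow p q \<alpha> f" by (simp add: Hnorm_pow_def g_def)
  then have "ennreal c * (\<integral>\<^sup>+ r. g ((1 - c) + c * r) \<partial>lborel) = Hnorm_pow p q \<alpha> f"
    using nn_integral_real_affine[of g c "1 - c"] c by simp
  moreover have "Hnorm_pow p q \<alpha> f < \<infinity>" using f by (simp add: Hspace_def)
  ultimately have "ennreal c * (\<integral>\<^sup>+ r. g ((1 - c) + c * r) \<partial>lborel) < \<infinity>" by simp
  then have "(\<integral>\<^sup>+ r. g ((1 - c) + c * r) \<partial>lborel) < \<infinity>"
    using c by (auto simp: ennreal_mult_less_top)
  then have 1: "(\<integral>\<^sup>+ r. D r \<partial>lborel) < \<infinity>"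
    unfolding D_def by (subst nn_integral_cmult) (auto simp: ennreal_mult_less_top)
  have 2: "D \<in> borel_measurable borel" unfolding D_def by measurable
  have 3: "ennreal (\<alpha> * q * (1 - r) powr (\<alpha> * q - 1) * Mp p (1 - c * (1 - r)) f powr q) = D r" if r: "0 < r" "r < 1" for r
  proof -
    define R where "R = 1 - c + c * r"
    have "c * (1 - r) < 1 * 1" using c r by (intro mult_strict_mono) auto
    moreover have "0 < c * (1 - r)" using c r by simp
    ultimately have R: "0 < R" "R < 1" "1 - R = c * (1 - r)" by (auto simp: R_def algebra_simps)
    have "c powr (1 - \<alpha> * q) * c powr (\<alpha> * q - 1) = 1" using c by (simp add: powr_add[symmetric])
    then have eq: "\<alpha> * q * (1 - r) powr (\<alpha> * q - 1) * Mp p R f powr q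
       = c powr (1 - \<alpha> * q) * (\<alpha> * q * (1 - R) powr (\<alpha> * q - 1) * Mp p R f powr q)"
      unfolding R(3) powr_mult by (simp add: mult_ac)
    have "D r = ennreal (c powr (1 - \<alpha> * q) * (\<alpha> * q * (1 - R) powr (\<alpha> * q - 1) * Mp p R f powr q))"
      unfolding D_def g_def R_def[symmetric] using R aq by (subst ennreal_mult) auto
    also have "\<dots> = ennreal (\<alpha> * q * (1 - r) powr (\<alpha> * q - 1) * Mp p R f powr q)" unfolding eq ..
    also have "R = 1 - c * (1 - r)" by (simp add: R_def algebra_simps)
    finally show ?thesis by simp
  qed
  show thesis by (rule that[OF 2 1 3])
qed

text \<open>Subordination compares the mean at \<open>r\<close> with one at a larger radius, and the
  dilation lemma absorbs that change of radius.\<close>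

lemma Hspace_comp:
  assumes p: "0 < p" and aq: "0 < \<alpha>" "0 < q" and f: "f \<in> Hspace p q \<alpha>"
    and g: "g holomorphic_on ball 0 1" "g ` ball 0 1 \<subseteq> ball 0 1"
  shows "f \<circ> g \<in> Hspace p q \<alpha>"
proof -
  define b where "b = norm (g 0)"
  have b: "0 \<le> b" "b < 1" using g(2) by (auto simp: b_def image_subset_iff)
  define c where "c = (1 - b) / 4"
  have c: "0 < c" "c < 1" using b by (auto simp: c_def)
  have hf: "f holomorphic_on ball 0 1" using f by (simp add: Hspace_def)
  obtain C where C: "0 \<le> C" "\<And>r. 0 < r \<Longrightarrow> r < 1 \<Longrightarrow> Mp p r (f \<circ> g) \<le> C * Mp p (1 - c * (1 - r)) f"
    using Mp_comp_le[OF p b] hf g unfolding c_def b_def by (metis order_refl)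
  obtain D where D: "D \<in> borel_measurable borel" "(\<integral>\<^sup>+ r. D r \<partial>lborel) < \<infinity>"
    "\<And>r. 0 < r \<Longrightarrow> r < 1 \<Longrightarrow> ennreal (\<alpha> * q * (1 - r) powr (\<alpha> * q - 1) * Mp p (1 - c * (1 - r)) f powr q) = D r"
    using Hnorm_pow_dilation[OF p f c aq] by metis
  have hfg: "f \<circ> g holomorphic_on ball 0 1"
    by (rule holomorphic_on_compose[OF g(1) holomorphic_on_subset[OF hf g(2)]])
  have "Hnorm_pow p q \<alpha> (f \<circ> g) \<le> (\<integral>\<^sup>+ r. ennreal (C powr q) * D r \<partial>lborel)"
    unfolding Hnorm_pow_def
  proof (rule nn_integral_mono)
    fix r :: real
    show "indicator {0<..<1} r * ennreal (\<alpha> * q * (1 - r) powr (\<alpha> * q - 1) * Mp p r (f \<circ> g) powr q) \<le> ennreal (C powr q) * D r"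
    proof (cases "0 < r \<and> r < 1")
      case True
      have "Mp p r (f \<circ> g) powr q \<le> (C * Mp p (1 - c * (1 - r)) f) powr q"
        using C(2) True aq Mp_nonneg[OF p holomorphic_on_imp_continuous_on[OF hfg]] by (intro powr_mono2) auto
      also have "\<dots> = C powr q * Mp p (1 - c * (1 - r)) f powr q" by (rule powr_mult)
      finally have "\<alpha> * q * (1 - r) powr (\<alpha> * q - 1) * Mp p r (f \<circ> g) powr q \<le>
         \<alpha> * q * (1 - r) powr (\<alpha> * q - 1) * (C powr q * Mp p (1 - c * (1 - r)) f powr q)"
        using aq by (intro mult_left_mono) auto
      also have "\<dots> = C powr q * (\<alpha> * q * (1 - r) powr (\<alpha> * q - 1) * Mp p (1 - c * (1 - r)) f powr q)"
        by (simp add: mult_ac)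
      finally have "ennreal (\<alpha> * q * (1 - r) powr (\<alpha> * q - 1) * Mp p r (f \<circ> g) powr q) \<le>
         ennreal (C powr q) * ennreal (\<alpha> * q * (1 - r) powr (\<alpha> * q - 1) * Mp p (1 - c * (1 - r)) f powr q)"
        using aq by (subst ennreal_mult[symmetric]) (auto intro: ennreal_leI)
      then show ?thesis using True D(3) by simp
    qed auto
  qed
  also have "\<dots> < \<infinity>" using D by (subst nn_integral_cmult) (auto simp: ennreal_mult_less_top)
  finally show ?thesis using hfg by (simp add: Hspace_def)
qed

text \<open>On a fixed circle \<open>\<phi> t\<close> tends uniformly to the identity, and
  \<open>f\<close> is uniformly continuous on a slightly larger closed disc.\<close>

lemma Mp_comp_diff_tendsto_0:
  assumes p: "0 < p" and sg: "analytic_semigroup \<phi>" and f: "f holomorphic_on ball 0 1" and r: "0 < r" "r < 1"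
  shows "((\<lambda>t. Mp p r (\<lambda>z. f (\<phi> t z) - f z)) \<longlongrightarrow> 0) (at_right 0)"
proof (rule tendstoI)
  fix e :: real assume e: "0 < e"
  define s where "s = (1 + r) / 2"
  have s: "r < s" "s < 1" using r by (auto simp: s_def)
  have fc: "continuous_on (ball 0 1) f" by (rule holomorphic_on_imp_continuous_on[OF f])
  have "uniformly_continuous_on (cball 0 s) f"
    by (intro compact_uniformly_continuous continuous_on_subset[OF fc]) (use s in auto)
  then obtain d where d: "0 < d" "\<And>x y. x \<in> cball 0 s \<Longrightarrow> y \<in> cball 0 s \<Longrightarrow> dist y x < d \<Longrightarrow> dist (f y) (f x) < e / 2"
    unfolding uniformly_continuous_on_def using e by (metis half_gt_zero)
  have "uniform_limit (cball 0 r) \<phi> (\<phi> 0) (at_right 0)"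
    using sg r unfolding analytic_semigroup_def by (auto simp: subset_eq)
  then have "eventually (\<lambda>t. \<forall>z\<in>cball 0 r. dist (\<phi> t z) (\<phi> 0 z) < min d (s - r)) (at_right 0)"
    using d s by (intro uniform_limitD) auto
  moreover have "eventually (\<lambda>t::real. 0 < t) (at_right 0)" by (simp add: eventually_at_filter)
  ultimately show "eventually (\<lambda>t. dist (Mp p r (\<lambda>z. f (\<phi> t z) - f z)) 0 < e) (at_right 0)"
  proof eventually_elim
    case (elim t)
    have \<phi>t: "\<phi> t holomorphic_on ball 0 1" "\<phi> t ` ball 0 1 \<subseteq> ball 0 1"
      using sg elim unfolding analytic_semigroup_def by auto
    have c: "continuous_on (ball 0 1) (\<lambda>z. f (\<phi> t z) - f z)"
      using \<phi>t by (intro continuous_intros fc continuous_on_compose2[OF fc] holomorphic_on_imp_continuous_on) auto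
    have "Mp p r (\<lambda>z. f (\<phi> t z) - f z) \<le> e / 2"
    proof (rule Mp_le_bound[OF p c])
      fix z :: complex assume z: "norm z = r"
      then have "\<phi> 0 z = z" using sg r unfolding analytic_semigroup_def by auto
      then have *: "dist (\<phi> t z) z < min d (s - r)" using bspec[OF elim(1), of z] z by simp
      have "norm (\<phi> t z) \<le> norm z + dist (\<phi> t z) z"
        using norm_triangle_sub[of "\<phi> t z" z] by (simp add: dist_norm)
      then have "dist (f (\<phi> t z)) (f z) < e / 2" using * z s by (intro d) auto
      then show "norm (f (\<phi> t z) - f z) \<le> e / 2" by (simp add: dist_norm)
    qed (use r e in auto)
    then show ?case using Mp_nonneg[OF p c, of r] r e by (simp add: dist_norm)
  qed
qed

text \<open>Dominated convergence in \<open>r\<close>. Once |phi_t(0)| <= 1/2, subordination has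
  constants independent of \<open>t\<close>, and the majorant combines the dilated integrand
  \<open>D\<close> with the integrand of \<open>f\<close>.\<close>

lemma Hnorm_comp_diff_tendsto_0:
  assumes p: "0 < p" and aq: "0 < \<alpha>" "0 < q" and sg: "analytic_semigroup \<phi>" and f: "f \<in> Hspace p q \<alpha>"
  shows "((\<lambda>t. Hnorm p q \<alpha> (\<lambda>z. f (\<phi> t z) - f z)) \<longlongrightarrow> 0) (at_right 0)"
proof -
  define G where "G h r = indicator {0<..<1} r * ennreal (\<alpha> * q * (1 - r) powr (\<alpha> * q - 1) * Mp p r h powr q)" for h r
  have hf: "f holomorphic_on ball 0 1" using f by (simp add: Hspace_def)
  have fc: "continuous_on (ball 0 1) f" by (rule holomorphic_on_imp_continuous_on[OF hf])
  have \<phi>t: "\<phi> t holomorphic_on ball 0 1" "\<phi> t ` ball 0 1 \<subseteq> ball 0 1" if "0 < t" for t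
    using sg that unfolding analytic_semigroup_def by auto
  have hft: "f \<circ> \<phi> t holomorphic_on ball 0 1" if "0 < t" for t
    by (rule holomorphic_on_compose[OF \<phi>t(1)[OF that] holomorphic_on_subset[OF hf \<phi>t(2)[OF that]]])
  obtain K where K: "0 \<le> K" "\<And>f g r. continuous_on (ball 0 1) f \<Longrightarrow> continuous_on (ball 0 1) g \<Longrightarrow> 0 \<le> r \<Longrightarrow> r < 1 \<Longrightarrow>
    Mp p r (\<lambda>z. f z - g z) \<le> K * (Mp p r f + Mp p r g)" using Mp_diff_le[OF p] by metis
  define c :: real where "c = (1 - 1/2) / 4"
  have c: "0 < c" "c < 1" by (auto simp: c_def)
  obtain C where C: "0 \<le> C" "\<And>f g r. \<lbrakk>f holomorphic_on ball 0 1; g holomorphic_on ball 0 1; g ` ball 0 1 \<subseteq> ball 0 1;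
     norm (g 0) \<le> 1/2; 0 < r; r < 1\<rbrakk> \<Longrightarrow> Mp p r (f \<circ> g) \<le> C * Mp p (1 - c * (1 - r)) f"
    using Mp_comp_le[OF p, of "1/2"] unfolding c_def by auto
  obtain D where D: "D \<in> borel_measurable borel" "(\<integral>\<^sup>+ r. D r \<partial>lborel) < \<infinity>"
    "\<And>r. 0 < r \<Longrightarrow> r < 1 \<Longrightarrow> ennreal (\<alpha> * q * (1 - r) powr (\<alpha> * q - 1) * Mp p (1 - c * (1 - r)) f powr q) = D r"
    using Hnorm_pow_dilation[OF p f c aq] by metis
  have "compact {0::complex} \<and> {0::complex} \<subseteq> ball 0 1" by simp
  then have "uniform_limit {0} \<phi> (\<phi> 0) (at_right 0)" "\<phi> 0 0 = 0"
    using sg unfolding analytic_semigroup_def by (blast, simp)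
  then have "eventually (\<lambda>t. \<forall>z\<in>{0}. dist (\<phi> t z) (\<phi> 0 z) < 1/2) (at_right 0)"
    by (intro uniform_limitD) auto
  then have "eventually (\<lambda>t. norm (\<phi> t 0) \<le> 1/2) (at_right 0)"
    by eventually_elim (use \<open>\<phi> 0 0 = 0\<close> in auto)
  then obtain t0 where t0: "0 < t0" "\<And>t. 0 < t \<Longrightarrow> t < t0 \<Longrightarrow> norm (\<phi> t 0) \<le> 1/2"
    by (auto simp: eventually_at_right[OF zero_less_one])
  define L where "L = K powr q * 2 powr q"
  have bound: "G (\<lambda>z. f (\<phi> t z) - f z) r \<le> ennreal L * (ennreal (C powr q) * D r + G f r)"
    if t: "0 < t" "t < t0" for t r
  proof (cases "0 < r \<and> r < 1")
    case True
    let ?w = "\<alpha> * q * (1 - r) powr (\<alpha> * q - 1)" and ?M = "Mp p (1 - c * (1 - r)) f"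
    have c1: "continuous_on (ball 0 1) (f \<circ> \<phi> t)" by (rule holomorphic_on_imp_continuous_on[OF hft[OF t(1)]])
    have cd: "continuous_on (ball 0 1) (\<lambda>z. f (\<phi> t z) - f z)" using continuous_on_diff[OF c1 fc] by simp
    have "Mp p r (\<lambda>z. f (\<phi> t z) - f z) \<le> K * (Mp p r (f \<circ> \<phi> t) + Mp p r f)"
      using K(2)[OF c1 fc, of r] True by simp
    also have "\<dots> \<le> K * (C * ?M + Mp p r f)"
      using C(2)[OF hf \<phi>t[OF t(1)] t0(2)[OF t], of r] True K by (intro mult_left_mono add_right_mono) auto
    finally have "Mp p r (\<lambda>z. f (\<phi> t z) - f z) powr q \<le> (K * (C * ?M + Mp p r f)) powr q"
      using Mp_nonneg[OF p cd] True aq by (intro powr_mono2) auto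
    also have "\<dots> = K powr q * (C * ?M + Mp p r f) powr q" by (rule powr_mult)
    also have "\<dots> \<le> K powr q * (2 powr q * ((C * ?M) powr q + Mp p r f powr q))"
    proof -
      have "c * (1 - r) < 1" "0 < c * (1 - r)" using mult_strict_mono[of c 1 "1 - r" 1] c True by auto
      then have "0 \<le> C * ?M" using Mp_nonneg[OF p fc, of "1 - c * (1 - r)"] C(1) by simp
      then show ?thesis using Mp_nonneg[OF p fc, of r] True aq by (intro mult_left_mono powr_add_le) auto
    qed
    also have "\<dots> = L * (C powr q * ?M powr q + Mp p r f powr q)" by (simp add: L_def powr_mult mult.assoc)
    finally have "?w * Mp p r (\<lambda>z. f (\<phi> t z) - f z) powr q \<le> ?w * (L * (C powr q * ?M powr q + Mp p r f powr q))"
      using aq by (intro mult_left_mono) auto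
    also have "\<dots> = L * (C powr q * (?w * ?M powr q) + ?w * Mp p r f powr q)" by (simp add: algebra_simps)
    finally have "ennreal (?w * Mp p r (\<lambda>z. f (\<phi> t z) - f z) powr q) \<le> ennreal (L * (C powr q * (?w * ?M powr q) + ?w * Mp p r f powr q))"
      by (rule ennreal_leI)
    also have "\<dots> = ennreal L * (ennreal (C powr q) * ennreal (?w * ?M powr q) + ennreal (?w * Mp p r f powr q))"
      using aq by (simp add: ennreal_mult ennreal_plus L_def)
    finally show ?thesis using True D(3)[of r] by (simp add: G_def)
  qed (auto simp: G_def)
  have meas: "G h \<in> borel_measurable lborel" if "h holomorphic_on ball 0 1" for h
    unfolding G_def using Hnorm_pow_integrand_measurable[OF p that] by simp
  note [measurable] = D(1) meas[OF hf]
  have GH: "Hnorm_pow p q \<alpha> h = (\<integral>\<^sup>+ r. G h r \<partial>lborel)" for h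
    by (simp add: Hnorm_pow_def G_def)
  have hd: "(\<lambda>z. f (\<phi> t z) - f z) holomorphic_on ball 0 1" if "0 < t" for t
    using holomorphic_on_diff[OF hft[OF that] hf] by simp
  have "((\<lambda>t. Hnorm_pow p q \<alpha> (\<lambda>z. f (\<phi> t z) - f z)) \<longlongrightarrow> 0) (at_right 0)"
  \<comment> \<open>Dominated convergence is stated for sequences, so the one-sided limit is tested
    along sequences in the interval where the majorant holds.\<close>
  proof (rule tendsto_at_right_sequentially[OF t0(1)])
    fix S :: "nat \<Rightarrow> real"
    assume S: "\<And>n. 0 < S n" "\<And>n. S n < t0" "S \<longlonglongrightarrow> 0"
    have S': "filterlim S (at_right 0) sequentially"
      using S by (intro tendsto_imp_filterlim_at_right) auto
    have "(\<lambda>n. \<integral>\<^sup>+ r. G (\<lambda>z. f (\<phi> (S n) z) - f z) r \<partial>lborel) \<longlonglongrightarrow> (\<integral>\<^sup>+ r. 0 \<partial>(lborel :: real measure))"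
    proof (rule nn_integral_dominated_convergence[where w = "\<lambda>r. ennreal L * (ennreal (C powr q) * D r + G f r)"])
      show "(\<lambda>r. ennreal L * (ennreal (C powr q) * D r + G f r)) \<in> borel_measurable lborel"
        by measurable
      show "G (\<lambda>z. f (\<phi> (S n) z) - f z) \<in> borel_measurable lborel" for n by (intro meas hd S)
      show "AE r in lborel. G (\<lambda>z. f (\<phi> (S n) z) - f z) r \<le> ennreal L * (ennreal (C powr q) * D r + G f r)" for n
        by (intro AE_I2 bound S)
      have "(\<integral>\<^sup>+ r. ennreal L * (ennreal (C powr q) * D r + G f r) \<partial>lborel)
         = ennreal L * (ennreal (C powr q) * (\<integral>\<^sup>+ r. D r \<partial>lborel) + Hnorm_pow p q \<alpha> f)"
        unfolding GH by (subst nn_integral_cmult, measurable, subst nn_integral_add, measurable, subst nn_integral_cmult, measurable)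
      then show "(\<integral>\<^sup>+ r. ennreal L * (ennreal (C powr q) * D r + G f r) \<partial>lborel) < \<infinity>"
        using D(2) f by (simp add: ennreal_mult_less_top Hspace_def)
      show "AE r in lborel. (\<lambda>n. G (\<lambda>z. f (\<phi> (S n) z) - f z) r) \<longlonglongrightarrow> 0"
      proof (rule AE_I2)
        fix r :: real
        show "(\<lambda>n. G (\<lambda>z. f (\<phi> (S n) z) - f z) r) \<longlonglongrightarrow> 0"
        proof (cases "0 < r \<and> r < 1")
          case True
          have "(\<lambda>n. Mp p r (\<lambda>z. f (\<phi> (S n) z) - f z)) \<longlonglongrightarrow> 0"
            using True by (intro filterlim_compose[OF Mp_comp_diff_tendsto_0[OF p sg hf] S']) auto
          then have "(\<lambda>n. Mp p r (\<lambda>z. f (\<phi> (S n) z) - f z) powr q) \<longlonglongrightarrow> 0"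
            using aq True Mp_nonneg[OF p holomorphic_on_imp_continuous_on[OF hd[OF S(1)]]]
            by (intro tendsto_zero_powrI[where b=q] tendsto_const) auto
          then have "(\<lambda>n. \<alpha> * q * (1 - r) powr (\<alpha> * q - 1) * Mp p r (\<lambda>z. f (\<phi> (S n) z) - f z) powr q) \<longlonglongrightarrow> 0"
            by (rule tendsto_mult_right_zero)
          then have "(\<lambda>n. ennreal (\<alpha> * q * (1 - r) powr (\<alpha> * q - 1) * Mp p r (\<lambda>z. f (\<phi> (S n) z) - f z) powr q)) \<longlonglongrightarrow> ennreal 0"
            by (rule tendsto_ennrealI)
          then show ?thesis using True by (simp add: G_def)
        qed (simp add: G_def)
      qed
    qed auto
    then show "(\<lambda>n. Hnorm_pow p q \<alpha> (\<lambda>z. f (\<phi> (S n) z) - f z)) \<longlonglongrightarrow> 0"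
      by (simp add: GH)
  qed
  then have "((\<lambda>t. enn2real (Hnorm_pow p q \<alpha> (\<lambda>z. f (\<phi> t z) - f z))) \<longlongrightarrow> enn2real 0) (at_right 0)"
    by (intro tendsto_enn2real) auto
  then show ?thesis unfolding Hnorm_def
    using aq by (intro tendsto_zero_powrI[where b="1/q"] tendsto_const) auto
qed

subsection \<open>Norm estimates for kernels and point evaluations\<close>

lemma nn_integral_weight:
  fixes a d :: real
  assumes "0 < a" "0 < d"
  shows "(\<integral>\<^sup>+ s. ennreal (a * s powr (a - 1)) * indicator {0..d} s \<partial>lborel) = ennreal (d powr a)"
proof -
  have "((\<lambda>s. a * s powr (a - 1)) has_integral a * (d powr (a - 1 + 1) / (a - 1 + 1))) {0..d}"
    using assms by (intro has_integral_mult_right has_integral_powr_from_0) auto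
  then have "((\<lambda>s. a * s powr (a - 1)) has_integral d powr a) {0..d}" using assms by simp
  then show ?thesis using assms by (intro nn_integral_has_integral_lebesgue') auto
qed

text \<open>The exact value carries the constant a / (X - a), which \<open>2 * a \<le> X\<close>
  makes at most 1.\<close>

lemma nn_integral_weight_tail:
  fixes a d X :: real
  assumes "0 < a" "0 < d" "2 * a \<le> X"
  shows "(\<integral>\<^sup>+ s. ennreal (a * s powr (a - 1 - X)) * indicator {d..} s \<partial>lborel) \<le> ennreal (d powr (a - X))"
proof -
  have "((\<lambda>s. a * s powr (a - 1 - X)) has_integral a * (- (d powr (a - 1 - X + 1)) / (a - 1 - X + 1))) {d..}"
    using assms by (intro has_integral_mult_right has_integral_powr_to_inf) auto
  then have "(\<integral>\<^sup>+ s. ennreal (a * s powr (a - 1 - X)) * indicator {d..} s \<partial>lborel) = ennreal (a * (- (d powr (a - 1 - X + 1)) / (a - 1 - X + 1)))"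
    using assms by (intro nn_integral_has_integral_lebesgue') auto
  also have "a * (- (d powr (a - 1 - X + 1)) / (a - 1 - X + 1)) = a / (X - a) * d powr (a - X)"
    using assms by (simp add: field_simps)
  also have "\<dots> \<le> 1 * d powr (a - X)"
    using assms by (intro mult_right_mono) (auto simp: field_simps)
  finally show ?thesis by (simp add: ennreal_leI)
qed

lemma nn_integral_reflect:
  assumes "f \<in> borel_measurable borel"
  shows "(\<integral>\<^sup>+ r. f (1 - r) \<partial>lborel) = (\<integral>\<^sup>+ s. f s \<partial>(lborel :: real measure))"
  using nn_integral_real_affine[OF assms, of "-1" 1] by simp

text \<open>With d = (1 - |w|)/2, every radius from 1 - d to 1 is at least \<open>d\<close> beyond
  |w|, so the means there are at least \<open>m\<close> by \<open>norm_le_Mp\<close>. The weight has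
  mass d^(alpha q) on these radii.\<close>

lemma norm_le_Hnorm:
  assumes p: "0 < p" and aq: "0 < \<alpha>" "0 < q" and f: "f \<in> Hspace p q \<alpha>" and w: "norm w < 1"
  shows "norm (f w) * ((1 - norm w) / 4) powr real_of_ereal (inverse p) * ((1 - norm w) / 2) powr \<alpha> \<le> Hnorm p q \<alpha> f"
proof -
  define e where "e = real_of_ereal (inverse p)"
  define d where "d = (1 - norm w) / 2"
  define m where "m = norm (f w) * (d / 2) powr e"
  have e: "0 \<le> e" using p by (cases p) (auto simp: e_def)
  have d: "0 < d" "d < 1" using w norm_ge_zero[of w] by (auto simp: d_def simp del: norm_ge_zero)
  have m: "0 \<le> m" by (simp add: m_def)
  have hf: "f holomorphic_on ball 0 1" using f by (simp add: Hspace_def)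
  have fc: "continuous_on (ball 0 1) f" by (rule holomorphic_on_imp_continuous_on[OF hf])
  have mle: "m \<le> Mp p r f" if r: "1 - d \<le> r" "r < 1" for r
  proof -
    have rw: "norm w < r" "d \<le> r - norm w" using r d by (auto simp: d_def field_simps)
    have r0: "0 < r" using r d by linarith
    have "norm (f w) \<le> ((r + norm w) / (r - norm w)) powr e * Mp p r f"
      unfolding e_def by (rule norm_le_Mp[OF p hf rw(1) r(2)])
    also have "\<dots> \<le> (2 / d) powr e * Mp p r f"
      using Mp_nonneg[OF p fc, of r] r r0 rw d w e by (intro mult_right_mono powr_mono2 frac_le) auto
    finally have "m \<le> ((2 / d) powr e * Mp p r f) * (d / 2) powr e"
      unfolding m_def by (intro mult_right_mono) auto
    also have "\<dots> = ((2 / d) * (d / 2)) powr e * Mp p r f" unfolding powr_mult by (simp add: mult_ac)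
    also have "\<dots> = Mp p r f" using d by simp
    finally show ?thesis .
  qed
  have "ennreal ((m * d powr \<alpha>) powr q) = ennreal (m powr q) * ennreal (d powr (\<alpha> * q))"
    using aq m by (simp add: powr_mult powr_powr ennreal_mult)
  also have "\<dots> = ennreal (m powr q) * (\<integral>\<^sup>+ s. ennreal (\<alpha> * q * s powr (\<alpha> * q - 1)) * indicator {0..d} s \<partial>lborel)"
    using aq d by (subst nn_integral_weight) auto
  also have "\<dots> = ennreal (m powr q) * (\<integral>\<^sup>+ r. ennreal (\<alpha> * q * (1 - r) powr (\<alpha> * q - 1)) * indicator {0..d} (1 - r) \<partial>lborel)"
    by (subst nn_integral_reflect) auto
  also have "\<dots> = (\<integral>\<^sup>+ r. ennreal (m powr q) * (ennreal (\<alpha> * q * (1 - r) powr (\<alpha> * q - 1)) * indicator {0..d} (1 - r)) \<partial>lborel)"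
    by (rule nn_integral_cmult[symmetric]) auto
  also have "\<dots> \<le> Hnorm_pow p q \<alpha> f"
    unfolding Hnorm_pow_def
  proof (rule nn_integral_mono)
    fix r :: real
    show "ennreal (m powr q) * (ennreal (\<alpha> * q * (1 - r) powr (\<alpha> * q - 1)) * indicator {0..d} (1 - r)) \<le>
      indicator {0<..<1} r * ennreal (\<alpha> * q * (1 - r) powr (\<alpha> * q - 1) * Mp p r f powr q)"
    proof (cases "1 - d \<le> r \<and> r < 1")
      case True
      have "m powr q * (\<alpha> * q * (1 - r) powr (\<alpha> * q - 1)) \<le> Mp p r f powr q * (\<alpha> * q * (1 - r) powr (\<alpha> * q - 1))"
        using mle[of r] True m aq by (intro mult_right_mono powr_mono2) auto
      then have "ennreal (m powr q) * ennreal (\<alpha> * q * (1 - r) powr (\<alpha> * q - 1)) \<le> ennreal (\<alpha> * q * (1 - r) powr (\<alpha> * q - 1) * Mp p r f powr q)"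
        using aq by (subst ennreal_mult[symmetric]) (auto simp: mult_ac intro!: ennreal_leI)
      then show ?thesis using True d by (simp add: indicator_def)
    next
      case False
      \<comment> \<open>At \<open>r = 1\<close> the left side vanishes because
        \<open>0 powr x = 0\<close> for every exponent.\<close>
      then have "r = 1 \<or> 1 - r \<notin> {0..d}" by auto
      then show ?thesis by auto
    qed
  qed
  finally have "ennreal ((m * d powr \<alpha>) powr q) \<le> Hnorm_pow p q \<alpha> f" .
  from enn2real_mono[OF this] have "(m * d powr \<alpha>) powr q \<le> enn2real (Hnorm_pow p q \<alpha> f)"
    using f by (simp add: Hspace_def)
  then have "((m * d powr \<alpha>) powr q) powr (1/q) \<le> Hnorm p q \<alpha> f"
    unfolding Hnorm_def using aq by (intro powr_mono2) auto
  then have "m * d powr \<alpha> \<le> Hnorm p q \<alpha> f" using aq m by (simp add: powr_powr)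
  then show ?thesis by (simp add: m_def d_def e_def)
qed

text \<open>With s = 1 - r and d = 1 - |a|, the mean is at most A y^(e - N) for some y >= max(s, d).
  Splitting at s = d, with \<open>d\<close> used below and \<open>s\<close> above, gives two
  integrals of at most d^(alpha q - X) each. The power of 1 - |a| in \<open>A\<close> cancels these,
  and the factor (1/2)^(1/q) accounts for there being two.\<close>

lemma kernel_in_unit_ball:
  assumes p: "0 < p" and aq: "0 < \<alpha>" "0 < q" and a: "norm a < 1"
    and N: "2 * real_of_ereal (inverse p) + 2 * \<alpha> \<le> real N"
  defines "A \<equiv> (1/2) powr (1/q) * (1 - norm a) powr (real N - \<alpha> - real_of_ereal (inverse p))"
  shows "(\<lambda>z. of_real A / (1 - cnj a * z) ^ N) \<in> Hspace p q \<alpha>"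
    and "Hnorm p q \<alpha> (\<lambda>z. of_real A / (1 - cnj a * z) ^ N) \<le> 1"
proof -
  define e where "e = real_of_ereal (inverse p)"
  define d where "d = 1 - norm a"
  define X where "X = (real N - e) * q"
  let ?f = "\<lambda>z. complex_of_real A / (1 - cnj a * z) ^ N"
  have e: "0 \<le> e" using p by (cases p) (auto simp: e_def)
  have d: "0 < d" using a by (auto simp: d_def)
  have A: "0 \<le> A" by (simp add: A_def)
  have Ne: "2 * e \<le> real N" "2 * \<alpha> \<le> real N - e" using N[folded e_def] aq e by linarith+
  have X: "2 * (\<alpha> * q) \<le> X" unfolding X_def using mult_right_mono[OF Ne(2), of q] aq by simp
  have X0: "0 \<le> X" using X aq by (smt (verit) mult_pos_pos)
  have ne: "1 - cnj a * z \<noteq> 0" if "norm z < 1" for z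
    using one_minus_cnj_mult_ge[OF a refl that] by auto
  have hf: "?f holomorphic_on ball 0 1"
    by (intro holomorphic_intros) (use ne in auto)
  let ?u = "\<lambda>s. ennreal (\<alpha> * q * s powr (\<alpha> * q - 1)) * indicator {0..d} s"
  let ?v = "\<lambda>s. ennreal (\<alpha> * q * s powr (\<alpha> * q - 1 - X)) * indicator {d..} s"
  let ?w = "\<lambda>s. ennreal (A powr q) * (ennreal (d powr (- X)) * ?u s + ?v s)"
  have "Hnorm_pow p q \<alpha> ?f \<le> (\<integral>\<^sup>+ r. ?w (1 - r) \<partial>lborel)"
    unfolding Hnorm_pow_def
  proof (rule nn_integral_mono)
    fix r :: real
    show "indicator {0<..<1} r * ennreal (\<alpha> * q * (1 - r) powr (\<alpha> * q - 1) * Mp p r ?f powr q) \<le> ?w (1 - r)"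
    proof (cases "0 < r \<and> r < 1")
      case True
      define s where "s = 1 - r"
      define y where "y = 1 - norm a * r"
      have s: "0 < s" "s < 1" using True by (auto simp: s_def)
      have "norm a * r \<le> 1 * r" "norm a * r \<le> norm a * 1"
        using True a by (intro mult_right_mono mult_left_mono; simp)+
      then have y: "s \<le> y" "d \<le> y" by (auto simp: y_def s_def d_def)
      have "Mp p r ?f \<le> A * y powr (e - N)"
        unfolding y_def e_def using True Ne by (intro Mp_kernel_le p a A) (auto simp: e_def)
      then have "Mp p r ?f powr q \<le> (A * y powr (e - N)) powr q"
        using True aq Mp_nonneg[OF p holomorphic_on_imp_continuous_on[OF hf]] by (intro powr_mono2) auto
      also have "\<dots> = A powr q * y powr (- X)" by (simp add: powr_mult powr_powr X_def algebra_simps)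
      finally have "\<alpha> * q * s powr (\<alpha> * q - 1) * Mp p r ?f powr q \<le> \<alpha> * q * s powr (\<alpha> * q - 1) * (A powr q * y powr (- X))"
        using aq by (intro mult_left_mono) auto
      also have "\<dots> = A powr q * (\<alpha> * q * s powr (\<alpha> * q - 1) * y powr (- X))" by (simp add: mult_ac)
      finally have 1: "ennreal (\<alpha> * q * s powr (\<alpha> * q - 1) * Mp p r ?f powr q) \<le> ennreal (A powr q) * ennreal (\<alpha> * q * s powr (\<alpha> * q - 1) * y powr (- X))"
        using aq by (subst ennreal_mult[symmetric]) (auto intro!: ennreal_leI)
      have 2: "ennreal (\<alpha> * q * s powr (\<alpha> * q - 1) * y powr (- X)) \<le> ennreal (d powr (- X)) * ?u s + ?v s"
      proof (cases "s \<le> d")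
        case True
        have "\<alpha> * q * s powr (\<alpha> * q - 1) * y powr (- X) \<le> \<alpha> * q * s powr (\<alpha> * q - 1) * d powr (- X)"
          using y d X0 aq by (intro mult_left_mono powr_mono2') auto
        then have "ennreal (\<alpha> * q * s powr (\<alpha> * q - 1) * y powr (- X)) \<le> ennreal (d powr (- X)) * ?u s"
          using True s aq by (simp add: ennreal_mult[symmetric] mult_ac ennreal_leI)
        then show ?thesis by (simp add: add_increasing2)
      next
        case False
        have "\<alpha> * q * s powr (\<alpha> * q - 1) * y powr (- X) \<le> \<alpha> * q * s powr (\<alpha> * q - 1) * s powr (- X)"
          using y s X0 aq by (intro mult_left_mono powr_mono2') auto
        also have "\<dots> = \<alpha> * q * s powr (\<alpha> * q - 1 - X)" using powr_add[of s "\<alpha> * q - 1" "- X"] by simp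
        finally have "ennreal (\<alpha> * q * s powr (\<alpha> * q - 1) * y powr (- X)) \<le> ?v s"
          using False by (simp add: ennreal_leI)
        then show ?thesis by (simp add: add_increasing)
      qed
      show ?thesis using order_trans[OF 1 mult_left_mono[OF 2]] True by (simp add: s_def)
    qed auto
  qed
  also have "\<dots> = (\<integral>\<^sup>+ s. ?w s \<partial>lborel)" by (rule nn_integral_reflect) measurable
  also have "\<dots> = ennreal (A powr q) * (ennreal (d powr (- X)) * (\<integral>\<^sup>+ s. ?u s \<partial>lborel) + (\<integral>\<^sup>+ s. ?v s \<partial>lborel))"
    by (subst nn_integral_cmult, measurable, subst nn_integral_add, measurable, subst nn_integral_cmult, measurable)
  also have "\<dots> \<le> ennreal (A powr q) * (ennreal (d powr (- X)) * ennreal (d powr (\<alpha> * q)) + ennreal (d powr (\<alpha> * q - X)))"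
    using nn_integral_weight[of "\<alpha> * q" d] nn_integral_weight_tail[of "\<alpha> * q" d X] aq d X
    by (intro mult_left_mono add_mono) auto
  also have "\<dots> = ennreal (A powr q * (d powr (- X) * d powr (\<alpha> * q) + d powr (\<alpha> * q - X)))"
    by (simp add: ennreal_mult ennreal_plus)
  also have "d powr (- X) * d powr (\<alpha> * q) = d powr (\<alpha> * q - X)" by (simp add: powr_add[symmetric])
  also have "A powr q = (1/2) * d powr (X - \<alpha> * q)"
    unfolding A_def d_def[symmetric] e_def[symmetric] using aq
    by (simp add: powr_mult powr_powr X_def algebra_simps)
  also have "(1/2) * d powr (X - \<alpha> * q) * (d powr (\<alpha> * q - X) + d powr (\<alpha> * q - X)) = 1"
    using d by (simp add: powr_add[symmetric])
  finally have le: "Hnorm_pow p q \<alpha> ?f \<le> 1" by simp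
  then have "Hnorm_pow p q \<alpha> ?f < \<infinity>" by (rule le_less_trans) simp
  then show "?f \<in> Hspace p q \<alpha>" using hf by (simp add: Hspace_def)
  have "enn2real (Hnorm_pow p q \<alpha> ?f) \<le> 1" using enn2real_mono[OF le] by simp
  then show "Hnorm p q \<alpha> ?f \<le> 1" unfolding Hnorm_def using aq powr_mono2[of "1/q" _ 1] by simp
qed

subsection \<open>Uniformly continuous semigroups\<close>

text \<open>The maximum principle on the disc of radius \<open>s\<close> gives |h(z)| <= B (1 -
  s)/s, which tends to 0 as \<open>s\<close> tends to 1.\<close>

lemma holomorphic_eq_0_of_boundary_decay:
  assumes h: "h holomorphic_on ball 0 1" and b: "\<And>z. norm z < 1 \<Longrightarrow> norm z * norm (h z) \<le> B * (1 - norm z)"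
    and z: "norm z < 1"
  shows "h z = 0"
proof -
  have le: "norm (h z) \<le> B * (1 - s) / s" if s: "norm z < s" "s < 1" for s
  proof (rule maximum_modulus_frontier[of h "cball 0 s"])
    have s0: "0 < s" using s norm_ge_zero[of z] by linarith
    show "h holomorphic_on interior (cball 0 s)"
      by (rule holomorphic_on_subset[OF h]) (use s in auto)
    show "continuous_on (closure (cball 0 s)) h"
      by (rule continuous_on_subset[OF holomorphic_on_imp_continuous_on[OF h]]) (use s in auto)
    show "norm (h x) \<le> B * (1 - s) / s" if "x \<in> frontier (cball 0 s)" for x
    proof -
      have "norm x = s" using that s0 by auto
      then show ?thesis using b[of x] s s0 by (simp add: field_simps)
    qed
  qed (use s in auto)
  have "((\<lambda>s. B * (1 - s) / s) \<longlongrightarrow> B * (1 - 1) / 1) (at_left 1)"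
    by (intro tendsto_intros) auto
  moreover have "eventually (\<lambda>s. norm (h z) \<le> B * (1 - s) / s) (at_left 1)"
    using eventually_at_left_real[OF z] by eventually_elim (use le in auto)
  ultimately have "norm (h z) \<le> B * (1 - 1) / 1"
    by (intro tendsto_lowerbound) auto
  then show ?thesis by simp
qed

text \<open>Small operator norm only gives that \<open>u^N\<close> is close to \<open>1\<close> for \<open>u = (1 - |a|\<^sup>2) / (1 - cnj a g(a))\<close>, but
  the resulting lower bound \<open>|u| \<ge> 1/2\<close> already puts \<open>g(a)\<close> within \<open>O(1 - |a|)\<close> of \<open>a\<close>.\<close>

lemma comp_minus_id_small_imp_id:
  assumes p: "0 < p" and aq: "0 < \<alpha>" "0 < q"
  obtains \<epsilon> :: real where "0 < \<epsilon>" "\<And>g z. g holomorphic_on ball 0 1 \<Longrightarrow> g ` ball 0 1 \<subseteq> ball 0 1 \<Longrightarrow>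
    comp_minus_id_opnorm p q \<alpha> g < ereal \<epsilon> \<Longrightarrow> norm z < 1 \<Longrightarrow> g z = z"
proof -
  define e where "e = real_of_ereal (inverse p)"
  obtain N0 :: nat where N0: "2 * e + 2 * \<alpha> \<le> real N0" using real_arch_simple by blast
  define N where "N = Suc N0"
  have N: "2 * e + 2 * \<alpha> \<le> real N" "0 < N" using N0 by (auto simp: N_def)
  \<comment> \<open>Collects the constants lost in \<open>norm_le_Hnorm\<close>, the factor 2^N from
    1 - |a|^2 <= 2 (1 - |a|), and the normalisation in \<open>A\<close>; a norm below 1/(2C) then
    yields |u^N - 1| <= 1/2.\<close>
  define C where "C = 4 powr e * 2 powr \<alpha> * 2 ^ N / (1/2) powr (1/q)"
  have C: "0 < C" by (simp add: C_def)
  have main: "g z = z" if g: "g holomorphic_on ball 0 1" "g ` ball 0 1 \<subseteq> ball 0 1"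
    and op: "comp_minus_id_opnorm p q \<alpha> g < ereal (1 / (2 * C))" and z: "norm z < 1" for g z
  proof -
    have bound: "norm a * norm (g a - a) \<le> 6 * (1 - norm a)" if a: "norm a < 1" for a
    proof -
      define d where "d = 1 - norm a"
      define A where "A = (1/2) powr (1/q) * (1 - norm a) powr (real N - \<alpha> - e)"
      define f where "f z = complex_of_real A / (1 - cnj a * z) ^ N" for z
      define F where "F z = f (g z) - f z" for z
      define u where "u = of_real (1 - (norm a)\<^sup>2) / (1 - cnj a * g a)"
      have d: "0 < d" using a by (simp add: d_def)
      have A: "0 < A" using a by (simp add: A_def)
      have fH: "f \<in> Hspace p q \<alpha>" "Hnorm p q \<alpha> f \<le> 1"
        unfolding f_def A_def e_def by (intro kernel_in_unit_ball p aq a N[unfolded e_def])+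
      then have "(if F \<in> Hspace p q \<alpha> then ereal (Hnorm p q \<alpha> F) else \<infinity>) \<le> comp_minus_id_opnorm p q \<alpha> g"
        unfolding comp_minus_id_opnorm_def F_def by (intro SUP_upper2[of f]) auto
      then have "(if F \<in> Hspace p q \<alpha> then ereal (Hnorm p q \<alpha> F) else \<infinity>) < ereal (1 / (2 * C))"
        using op by (rule le_less_trans)
      \<comment> \<open>The value \<infinity> assigned outside the space cannot lie below a real
        number, so \<open>F\<close> belongs to the space.\<close>
      then have FH: "F \<in> Hspace p q \<alpha>" "Hnorm p q \<alpha> F < 1 / (2 * C)" by (auto split: if_splits)
      have ga: "norm (g a) < 1" using g(2) a by (auto simp: image_subset_iff)
      have ne: "1 - cnj a * g a \<noteq> 0" using one_minus_cnj_mult_ge[OF a refl ga] by auto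
      have aa: "cnj a * a = of_real ((norm a)\<^sup>2)" by (metis complex_norm_square mult.commute of_real_power)
      have d1: "0 < 1 - (norm a)\<^sup>2" "1 - (norm a)\<^sup>2 \<le> 2 * d"
      proof -
        have "1 - (norm a)\<^sup>2 = (1 + norm a) * d" by (simp add: d_def power2_eq_square algebra_simps)
        moreover have "(1 + norm a) * d \<le> 2 * d" using a d by (intro mult_right_mono) auto
        moreover have "0 < (1 + norm a) * d" using d by (intro mult_pos_pos) (auto intro: add_pos_nonneg)
        ultimately show "0 < 1 - (norm a)\<^sup>2" "1 - (norm a)\<^sup>2 \<le> 2 * d" by simp_all
      qed
      \<comment> \<open>Multiplication by (1 - |a|^2)^N turns the kernel value at \<open>a\<close>
        into \<open>A\<close> and the one at \<open>g a\<close> into A u^N.\<close>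
      have "F a * of_real (1 - (norm a)\<^sup>2) ^ N = of_real A * (u ^ N - 1)"
      proof -
        have "1 - cnj a * a = of_real (1 - (norm a)\<^sup>2)" unfolding aa by simp
        moreover have "complex_of_real (1 - (norm a)\<^sup>2) \<noteq> 0" using d1 by (simp only: of_real_eq_0_iff)
        ultimately have "f a * of_real (1 - (norm a)\<^sup>2) ^ N = of_real A"
          unfolding f_def by (simp del: of_real_power of_real_diff)
        moreover have "f (g a) * of_real (1 - (norm a)\<^sup>2) ^ N = of_real A * u ^ N"
          by (simp add: f_def u_def power_divide)
        ultimately show ?thesis by (simp add: F_def algebra_simps)
      qed
      then have "norm (F a * of_real (1 - (norm a)\<^sup>2) ^ N) = norm (of_real A * (u ^ N - 1))" by simp
      then have "norm (F a) * (1 - (norm a)\<^sup>2) ^ N = A * norm (u ^ N - 1)"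
        using d1 A by (simp add: norm_mult norm_power del: of_real_power of_real_diff)
      then have "A * norm (u ^ N - 1) = norm (F a) * (1 - (norm a)\<^sup>2) ^ N" by simp
      also have "\<dots> \<le> norm (F a) * (2 * d) ^ N"
        using d1 by (intro mult_left_mono power_mono) auto
      finally have 1: "A * norm (u ^ N - 1) \<le> norm (F a) * (2 * d) ^ N" .
      have "norm (F a) * (d / 4) powr e * (d / 2) powr \<alpha> \<le> 1 / (2 * C)"
        using norm_le_Hnorm[OF p aq FH(1) a] FH(2) by (simp add: d_def e_def)
      then have "(norm (F a) * (d / 4) powr e * (d / 2) powr \<alpha>) * C \<le> 1 / (2 * C) * C"
        using C by (intro mult_right_mono) auto
      also have "\<dots> = 1/2" using C by simp
      finally have 2: "(norm (F a) * (d / 4) powr e * (d / 2) powr \<alpha>) * C \<le> 1/2" .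
      \<comment> \<open>The powers of \<open>d\<close> balance: e + alpha from point evaluation and
        N - alpha - e from \<open>A\<close> make exactly \<open>N\<close>, so the final bound does
        not depend on \<open>a\<close>.\<close>
      have E: "(norm (F a) * (d / 4) powr e * (d / 2) powr \<alpha>) * C * A = norm (F a) * (2 * d) ^ N"
      proof -
        have dN: "d ^ N = d powr e * d powr \<alpha> * d powr (real N - \<alpha> - e)"
          using d by (simp add: powr_add[symmetric] powr_realpow)
        show ?thesis
          unfolding C_def A_def d_def[symmetric] power_mult_distrib dN
          by (simp add: powr_divide)
      qed
      have "norm (F a) * (2 * d) ^ N \<le> 1/2 * A"
        unfolding E[symmetric] using A by (intro mult_right_mono 2) auto
      with 1 have "A * norm (u ^ N - 1) \<le> A * (1/2)" by (simp add: mult.commute)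
      then have "norm (u ^ N - 1) \<le> 1/2" using A by (rule mult_left_le_imp_le)
      then have uN: "1/2 \<le> norm u ^ N"
        using norm_triangle_ineq2[of 1 "u ^ N"] by (simp add: norm_power norm_minus_commute)
      have "1/2 \<le> norm u"
      proof (rule ccontr)
        assume "\<not> ?thesis"
        then have "norm u < 1/2" by simp
        moreover have "norm u ^ N \<le> norm u ^ 1"
          using \<open>norm u < 1/2\<close> N(2) by (intro power_decreasing) auto
        ultimately show False using uN by simp
      qed
      also have "norm u = (1 - (norm a)\<^sup>2) / norm (1 - cnj a * g a)"
        using d1 by (simp add: u_def norm_divide del: of_real_power of_real_diff)
      finally have 3: "norm (1 - cnj a * g a) \<le> 2 * (1 - (norm a)\<^sup>2)"
        using ne by (simp add: field_simps)
      have "norm a * norm (g a - a) = norm (cnj a * (g a - a))" by (simp add: norm_mult)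
      \<comment> \<open>Both terms of this difference are controlled by 1 - |a|^2, with factors 1
        and 2; as 1 - |a|^2 <= 2 (1 - |a|), the total constant is 6.\<close>
      also have "cnj a * (g a - a) = of_real (1 - (norm a)\<^sup>2) - (1 - cnj a * g a)"
        by (simp add: right_diff_distrib aa del: of_real_power)
      also have "norm \<dots> \<le> (1 - (norm a)\<^sup>2) + norm (1 - cnj a * g a)"
        using norm_triangle_ineq4[of "of_real (1 - (norm a)\<^sup>2)" "1 - cnj a * g a"] d1
        by (simp del: of_real_power of_real_diff)
      also have "\<dots> \<le> (1 - (norm a)\<^sup>2) + 2 * (1 - (norm a)\<^sup>2)" using 3 by (intro add_left_mono)
      also have "\<dots> = 3 * (1 - (norm a)\<^sup>2)" by simp
      also have "\<dots> \<le> 3 * (2 * d)" using d1(2) by (intro mult_left_mono) auto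
      also have "\<dots> = 6 * d" by simp
      finally show ?thesis by (simp add: d_def)
    qed
    have "(\<lambda>x. g x - x) holomorphic_on ball 0 1" by (intro holomorphic_intros g)
    from holomorphic_eq_0_of_boundary_decay[OF this bound z] show ?thesis by simp
  qed
  show thesis
  proof (rule that[of "1 / (2 * C)"])
    show "0 < 1 / (2 * C)" using C by simp
  qed (rule main)
qed

text \<open>Carries triviality from small times to all times, since any \<open>t\<close> is a
  multiple of \<open>t / n\<close> with \<open>n\<close> large.\<close>

lemma analytic_semigroup_iterate:
  assumes sg: "analytic_semigroup \<phi>" and s: "0 \<le> s" "\<And>z. norm z < 1 \<Longrightarrow> \<phi> s z = z" and z: "norm z < 1"
  shows "\<phi> (real n * s) z = z"
proof (induction n)
  case 0
  then show ?case using sg z by (simp add: analytic_semigroup_def)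
next
  case (Suc n)
  have "\<phi> (real (Suc n) * s) z = \<phi> (real n * s + s) z" by (simp add: algebra_simps)
  also have "\<dots> = \<phi> (real n * s) (\<phi> s z)" using sg z s(1) by (simp add: analytic_semigroup_def)
  finally show ?case using Suc s(2)[OF z] by simp
qed

lemma uniformly_continuous_imp_trivial:
  assumes p: "0 < p" and aq: "0 < \<alpha>" "0 < q" and sg: "analytic_semigroup \<phi>"
    and lim: "((\<lambda>t. comp_minus_id_opnorm p q \<alpha> (\<phi> t)) \<longlongrightarrow> 0) (at_right 0)"
  shows "trivial_semigroup \<phi>"
proof -
  obtain \<epsilon> where \<epsilon>: "0 < \<epsilon>" "\<And>g z. g holomorphic_on ball 0 1 \<Longrightarrow> g ` ball 0 1 \<subseteq> ball 0 1 \<Longrightarrow>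
    comp_minus_id_opnorm p q \<alpha> g < ereal \<epsilon> \<Longrightarrow> norm z < 1 \<Longrightarrow> g z = z"
    using comp_minus_id_small_imp_id[OF p aq] by metis
  have "eventually (\<lambda>t. comp_minus_id_opnorm p q \<alpha> (\<phi> t) < ereal \<epsilon>) (at_right 0)"
    by (rule order_tendstoD(2)[OF lim]) (use \<epsilon> in auto)
  then obtain t0 where t0: "0 < t0" "\<And>t. 0 < t \<Longrightarrow> t < t0 \<Longrightarrow> comp_minus_id_opnorm p q \<alpha> (\<phi> t) < ereal \<epsilon>"
    by (auto simp: eventually_at_right[OF zero_less_one])
  have small: "\<phi> t z = z" if "0 < t" "t < t0" "norm z < 1" for t z
    by (rule \<epsilon>(2)) (use sg t0 that in \<open>auto simp: analytic_semigroup_def\<close>)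
  show ?thesis
    unfolding trivial_semigroup_def
  proof (intro allI impI ballI)
    fix t :: real and z :: complex assume t: "0 \<le> t" and z: "z \<in> ball 0 1"
    show "\<phi> t z = z"
    proof (cases "t = 0")
      case True
      then show ?thesis using sg z by (simp add: analytic_semigroup_def)
    next
      case False
      obtain n :: nat where n: "t / t0 < real n" using reals_Archimedean2 by blast
      have "0 < t / t0" using False t t0 by simp
      then have n0: "0 < real n" using n by linarith
      have "\<phi> (real n * (t / real n)) z = z"
        using False t t0 n n0 z
        by (intro analytic_semigroup_iterate[OF sg] small) (auto simp: field_simps)
      then show ?thesis using n0 by simp
    qed
  qed
qed

theorem theorem4p2:
  fixes p :: ereal and q \<alpha> :: real
  assumes "0 < p" and "0 < q" and "0 < \<alpha>"
  shows
    "(\<forall>\<phi>. analytic_semigroup \<phi> \<longrightarrow>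
        (\<forall>t\<ge>0. \<forall>f\<in>Hspace p q \<alpha>. f \<circ> \<phi> t \<in> Hspace p q \<alpha>) \<and>
        (\<forall>f\<in>Hspace p q \<alpha>.
           ((\<lambda>t. Hnorm p q \<alpha> (\<lambda>z. f (\<phi> t z) - f z)) \<longlongrightarrow> 0) (at_right 0))) \<and>
     (\<forall>\<phi>. analytic_semigroup \<phi> \<longrightarrow>
        ((\<lambda>t. comp_minus_id_opnorm p q \<alpha> (\<phi> t)) \<longlongrightarrow> 0) (at_right 0) \<longrightarrow>
        trivial_semigroup \<phi>)"
proof (intro conjI allI impI ballI)
  fix \<phi> f and t :: real
  assume "analytic_semigroup \<phi>" "0 \<le> t" "f \<in> Hspace p q \<alpha>"
  then show "f \<circ> \<phi> t \<in> Hspace p q \<alpha>"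
    using assms by (intro Hspace_comp) (auto simp: analytic_semigroup_def)
next
  fix \<phi> f
  assume "analytic_semigroup \<phi>" "f \<in> Hspace p q \<alpha>"
  then show "((\<lambda>t. Hnorm p q \<alpha> (\<lambda>z. f (\<phi> t z) - f z)) \<longlongrightarrow> 0) (at_right 0)"
    using assms by (intro Hnorm_comp_diff_tendsto_0)
next
  fix \<phi>
  assume "analytic_semigroup \<phi>" "((\<lambda>t. comp_minus_id_opnorm p q \<alpha> (\<phi> t)) \<longlongrightarrow> 0) (at_right 0)"
  then show "trivial_semigroup \<phi>"
    using assms by (intro uniformly_continuous_imp_trivial)
qed

end
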